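(* Let $\mathcal{A}$ be a symmetric prediction algorithm and let the conformity score be the absolute out-of-sample prediction error $\mathcal{C}^{\mathrm{out}}$ based on $\mathcal{A}$. Then the shortcut prediction sets coincide with the symmetrized Jackknife: $PS^{\mathrm{sc}}_{n,\alpha}(\delta)=PI^{\mathrm{sJ}}_{n,\alpha}(\delta)$. If $\mathcal{A}$ is asymptotically out-of-sample stable, then the symmetrized Jackknife prediction intervals are asymptotically conditionally equivalent to the full conformal prediction sets based on $\mathcal{C}^{\mathrm{out}}$ in the following sense: (i) The statement "for all $\delta,\epsilon>0$: $\lim_{n\to\infty}\mathbb{P}\big(\sup_{\alpha\in[0,1]}[\mathbb{P}(y_{n+1}\notin PS^{\mathrm{fc}}_{n,\alpha}(\delta)\,\|\,\mathcal{T}_n)-\alpha]\ge\epsilon\big)=0$" holds if and only if the same statement holds with $PS^{\mathrm{fc}}_{n,\alpha}(\delta)$ replaced by $PI^{\mathrm{sJ}}_{n,\alpha}(\delta)$. (ii) If, additionally, the continuous case assumption CC is fulfilled for $\mathcal{C}^{\mathrm{out}}$, then $\lim_{n\to\infty}\mathbb{E}\big(\sup_{\alpha\in[0,1]}|\mathbb{P}(y_{n+1}\notin PS^{\mathrm{fc}}_{n,\alpha}(0)\,\|\,\mathcal{T}_n)-\alpha|\big)=0$ if and only if the same holds with $PS^{\mathrm{fc}}_{n,\alpha}(0)$ replaced by $PI^{\mathrm{sJ}}_{n,\alpha}(0)$.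
   Context: Setting. For every $n\in\mathbb{N}$, $P_n$ is a regular Borel probability measure on $\mathcal{Z}_n=\mathcal{Y}_n\times\mathcal{X}_n$, where $\mathcal{Y}_n\subseteq\mathbb{R}$ is a (possibly unbounded) interval and $\mathcal{X}_n$ is a Euclidean space of dimension $p_n\in\mathbb{N}$. For each $n$, $t_i=t_i^{(n)}=(y_i,x_i)$, $1\le i\le n+1$, are i.i.d. with distribution $P_n$ (which may depend on $n$). Put $\mathcal{T}_n=(t_1,\dots,t_n)$, and let $\mathcal{T}_n^{\setminus i}$ denote $\mathcal{T}_n$ with $t_i$ removed. $\mathbb{P}(\cdot\,\|\,\mathcal{T}_n)$ denotes conditional probability given $\mathcal{T}_n$. Prediction algorithms. A prediction algorithm is a family $\mathcal{A}=(\mathcal{A}_{n,m})_{n,m\in\mathbb{N}}$ of measurable functions $\mathcal{A}_{n,m}:\mathcal{X}_n\times\mathcal{Z}_n^m\to\mathcal{Y}_n$; it is symmetric if it is invariant under permutations of the $m$ training points. A symmetric $\mathcal{A}$ is asymptotically out-of-sample stable if $\mathcal{A}_{n,n}(x_{n+1},\mathcal{T}_n)-\mathcal{A}_{n,n-1}(x_{n+1},\mathcal{T}_n^{\setminus n})\to0$ in probability as $n\to\infty$. Conformity score. For $T\in\mathcal{Z}_n^m$, $\mathcal{C}_m((y,x),T)=\mathcal{C}^{\mathrm{out}}_m((y,x),T)=|y-\mathcal{A}_{n,m}(x,T)|$. Continuous case assumption (CC): for every $n\in\mathbb{N}$ and almost every $\mathcal{T}_n$, the distribution of $\mathcal{C}_n(t_{n+1},\mathcal{T}_n)$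 conditional on $\mathcal{T}_n$ is absolutely continuous with density $f_{\mathcal{T}_n}$, and $(\|f_{\mathcal{T}_n}\|_\infty)_{n\in\mathbb{N}}$ is stochastically bounded, where $\|f\|_\infty=\sup_x|f(x)|$. Quantiles. For a cdf $F$ and $\alpha\in\mathbb{R}$, $F^{-1}(\alpha)=\inf\{x\in\mathbb{R}:F(x)\ge\alpha\}\in[-\infty,\infty]$ with $\inf\emptyset=+\infty$. For real $c$, $c\le+\infty$ is true and $c\le-\infty$ is false. Full conformal prediction sets. For $y\in\mathcal{Y}_n$ let $\mathcal{D}_{n+1}^y=(t_1,\dots,t_n,(y,x_{n+1}))$ and $$\hat F_y(s)=\frac{1}{n+1}\mathbf{1}\{\mathcal{C}_n((y,x_{n+1}),\mathcal{T}_n)\le s\}+\frac1{n+1}\sum_{i=1}^n\mathbf{1}\{\mathcal{C}_n(t_i,\mathcal{D}_{n+1}^y\setminus t_i)\le s\},$$ where $\mathcal{D}_{n+1}^y\setminus t_i$ is $\mathcal{D}_{n+1}^y$ with its $i$-th entry removed. For $\alpha,\delta\in\mathbb{R}$, $PS^{\mathrm{fc}}_{n,\alpha}(\delta)=\{y\in\mathcal{Y}_n:\mathcal{C}_n((y,x_{n+1}),\mathcal{T}_n)\le\hat F_y^{-1}(1-\alpha)+\delta\}$. Shortcut prediction sets. $PS^{\mathrm{sc}}_{n,\alpha}(\delta)=\{y\in\mathcal{Y}_n:\mathcal{C}_n((y,x_{n+1}),\mathcal{T}_n)\le\hat G^{-1}(1-\alpha)+\delta\}$, where $\hat G(s)=\frac1n\sum_{i=1}^n\mathbf{1}\{\mathcal{C}_{n-1}(t_i,\mathcal{T}_n^{\setminus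 i})\le s\}$. Symmetrized Jackknife. With leave-one-out residuals $\hat u_i=y_i-\mathcal{A}_{n,n-1}(x_i,\mathcal{T}_n^{\setminus i})$, $1\le i\le n$, and $q=\inf\{x\in\mathbb{R}:\frac1n\sum_{i=1}^n\mathbf{1}\{|\hat u_i|\le x\}\ge1-\alpha\}\in[-\infty,\infty]$ (with $\inf\emptyset=+\infty$) the $(1-\alpha)$-quantile of the empirical distribution function of $|\hat u_1|,\dots,|\hat u_n|$, the $\delta$-inflated symmetrized Jackknife prediction interval $PI^{\mathrm{sJ}}_{n,\alpha}(\delta)$ is the set of $y\in\mathcal{Y}_n$ lying in $\mathcal{A}_{n,n}(x_{n+1},\mathcal{T}_n)+[-q-\delta,\,q+\delta]$. *)

theory Defs
  imports "HOL-Probability.Probability"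
begin

section \<open>Observations, samples and prediction algorithms\<close>

text \<open>The dimension of the covariates varies with \<open>n\<close>, so a point of the Euclidean space of
  dimension \<open>k\<close> is a function that is extensional on \<open>{..<k}\<close>, and the Borel sets are those of
  the product measurable space. An observation is a pair (response, covariate), and a sample of
  size \<open>m\<close> is a function that is extensional on \<open>{1..m}\<close>.\<close>

type_synonym covariate = "nat \<Rightarrow> real"
type_synonym observation = "real \<times> covariate"
type_synonym sample = "nat \<Rightarrow> observation"

definition covariate_space :: "nat \<Rightarrow> covariate measure" where
  "covariate_space k = (\<Pi>\<^sub>M j\<in>{..<k}. (borel :: real measure))"

definition observation_space :: "real set \<Rightarrow> nat \<Rightarrow> observation measure" where
  "observation_space R k = restrict_space borel R \<Otimes>\<^sub>M covariate_space k"

definition sample_space :: "real set \<Rightarrow> nat \<Rightarrow> nat \<Rightarrow> sample measure" where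
  "sample_space R k m = (\<Pi>\<^sub>M i\<in>{1..m}. observation_space R k)"

text \<open>\<open>drop_entry m i T\<close> removes the \<open>i\<close>-th entry from a sample \<open>T\<close> of size \<open>m\<close> and renumbers
  the later entries.\<close>

definition drop_entry :: "nat \<Rightarrow> nat \<Rightarrow> sample \<Rightarrow> sample" where
  "drop_entry m i T = (\<lambda>j\<in>{1..m - 1}. if j < i then T j else T (Suc j))"

text \<open>The value \<open>A n m x T\<close> is the prediction at \<open>x\<close>, for the \<open>n\<close>-th model, from the training
  sample \<open>T\<close> of size \<open>m\<close>. The size \<open>m = 0\<close> is needed for leaving one out when \<open>n = 1\<close>.\<close>

type_synonym algorithm = "nat \<Rightarrow> nat \<Rightarrow> covariate \<Rightarrow> sample \<Rightarrow> real"

definition prediction_algorithm :: "(nat \<Rightarrow> real set) \<Rightarrow> (nat \<Rightarrow> nat) \<Rightarrow> algorithm \<Rightarrow> bool" where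
  "prediction_algorithm Y p A \<longleftrightarrow>
    (\<forall>n\<ge>1. \<forall>m. (\<lambda>(x, T). A n m x T) \<in>
      covariate_space (p n) \<Otimes>\<^sub>M sample_space (Y n) (p n) m \<rightarrow>\<^sub>M restrict_space borel (Y n))"

definition symmetric_algorithm :: "(nat \<Rightarrow> real set) \<Rightarrow> (nat \<Rightarrow> nat) \<Rightarrow> algorithm \<Rightarrow> bool" where
  "symmetric_algorithm Y p A \<longleftrightarrow>
    (\<forall>n\<ge>1. \<forall>m. \<forall>x\<in>space (covariate_space (p n)). \<forall>T\<in>space (sample_space (Y n) (p n) m).
      \<forall>\<pi>. \<pi> permutes {1..m} \<longrightarrow> A n m x (\<lambda>i\<in>{1..m}. T (\<pi> i)) = A n m x T)"

section \<open>Prediction sets\<close>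

type_synonym conformity_score = "nat \<Rightarrow> nat \<Rightarrow> observation \<Rightarrow> sample \<Rightarrow> real"

definition score_out :: "algorithm \<Rightarrow> conformity_score" where
  "score_out A n m z T = \<bar>fst z - A n m (snd z) T\<bar>"

definition quantile :: "(real \<Rightarrow> real) \<Rightarrow> real \<Rightarrow> ereal" where
  "quantile F a = Inf (ereal ` {x. F x \<ge> a})"

text \<open>A prediction set is a function of \<open>n\<close>, the level \<open>\<alpha>\<close>, the inflation \<open>\<delta>\<close>, the training
  sample of size \<open>n\<close> and the new covariate. In \<open>fc_cdf\<close>, \<open>T(n + 1 := (y, x))\<close> is the augmented
  sample of size \<open>n + 1\<close>.\<close>

type_synonym prediction_set = "nat \<Rightarrow> real \<Rightarrow> real \<Rightarrow> sample \<Rightarrow> covariate \<Rightarrow> real set"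

definition fc_cdf :: "conformity_score \<Rightarrow> nat \<Rightarrow> sample \<Rightarrow> covariate \<Rightarrow> real \<Rightarrow> real \<Rightarrow> real" where
  "fc_cdf C n T x y s =
    1 / (real n + 1) * of_bool (C n n (y, x) T \<le> s) +
    1 / (real n + 1) *
      (\<Sum>i=1..n. of_bool (C n n (T i) (drop_entry (n + 1) i (T(n + 1 := (y, x)))) \<le> s))"

definition PS_fc :: "(nat \<Rightarrow> real set) \<Rightarrow> conformity_score \<Rightarrow> prediction_set" where
  "PS_fc Y C n \<alpha> \<delta> T x =
    {y \<in> Y n. ereal (C n n (y, x) T) \<le> quantile (fc_cdf C n T x y) (1 - \<alpha>) + ereal \<delta>}"

definition sc_cdf :: "conformity_score \<Rightarrow> nat \<Rightarrow> sample \<Rightarrow> real \<Rightarrow> real" where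
  "sc_cdf C n T s =
    1 / real n * (\<Sum>i=1..n. of_bool (C n (n - 1) (T i) (drop_entry n i T) \<le> s))"

definition PS_sc :: "(nat \<Rightarrow> real set) \<Rightarrow> conformity_score \<Rightarrow> prediction_set" where
  "PS_sc Y C n \<alpha> \<delta> T x =
    {y \<in> Y n. ereal (C n n (y, x) T) \<le> quantile (sc_cdf C n T) (1 - \<alpha>) + ereal \<delta>}"

definition loo_residual :: "algorithm \<Rightarrow> nat \<Rightarrow> sample \<Rightarrow> nat \<Rightarrow> real" where
  "loo_residual A n T i = fst (T i) - A n (n - 1) (snd (T i)) (drop_entry n i T)"

definition sJ_quantile :: "algorithm \<Rightarrow> nat \<Rightarrow> real \<Rightarrow> sample \<Rightarrow> ereal" where
  "sJ_quantile A n \<alpha> T =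
    quantile (\<lambda>s. 1 / real n * (\<Sum>i=1..n. of_bool (\<bar>loo_residual A n T i\<bar> \<le> s))) (1 - \<alpha>)"

definition PI_sJ :: "(nat \<Rightarrow> real set) \<Rightarrow> algorithm \<Rightarrow> prediction_set" where
  "PI_sJ Y A n \<alpha> \<delta> T x =
    {y \<in> Y n. ereal (y - A n n x T) \<in>
      {- sJ_quantile A n \<alpha> T - ereal \<delta> .. sJ_quantile A n \<alpha> T + ereal \<delta>}}"

section \<open>Probabilistic notions\<close>

definition random_sample :: "(nat \<Rightarrow> nat \<Rightarrow> 'w \<Rightarrow> observation) \<Rightarrow> nat \<Rightarrow> nat \<Rightarrow> 'w \<Rightarrow> sample" where
  "random_sample t n m \<omega> = (\<lambda>i\<in>{1..m}. t n i \<omega>)"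

definition training_algebra ::
    "'w measure \<Rightarrow> (nat \<Rightarrow> real set) \<Rightarrow> (nat \<Rightarrow> nat) \<Rightarrow> (nat \<Rightarrow> nat \<Rightarrow> 'w \<Rightarrow> observation) \<Rightarrow> nat \<Rightarrow> 'w measure"
  where
  "training_algebra M Y p t n =
    vimage_algebra (space M) (random_sample t n n) (sample_space (Y n) (p n) n)"

text \<open>Conditional probabilities of uncountably many events occur below a supremum, so they are
  taken from a regular conditional distribution: \<open>\<kappa>\<close> is a probability kernel, measurable with
  respect to the sub-\<open>\<sigma>\<close>-algebra \<open>F\<close>, such that \<open>\<lambda>\<omega>. \<kappa> \<omega> B\<close> is for every \<open>B\<close> a version of the
  conditional probability of \<open>X \<in> B\<close> given \<open>F\<close>.\<close>

definition regular_cond_distr ::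
    "'w measure \<Rightarrow> 'w measure \<Rightarrow> 'b measure \<Rightarrow> ('w \<Rightarrow> 'b) \<Rightarrow> ('w \<Rightarrow> 'b measure) \<Rightarrow> bool" where
  "regular_cond_distr M F N X \<kappa> \<longleftrightarrow>
    \<kappa> \<in> F \<rightarrow>\<^sub>M prob_algebra N \<and>
    (\<forall>B\<in>sets N. AE \<omega> in M.
      measure (\<kappa> \<omega>) B = real_cond_exp M F (indicator (X -` B \<inter> space M)) \<omega>)"

text \<open>Below, \<open>\<kappa> n\<close> is the conditional distribution of the sample of size \<open>n + 1\<close> given the
  first \<open>n\<close> observations; \<open>d\<close> ranges over samples of size \<open>n + 1\<close>.\<close>

definition miscoverage ::
    "(nat \<Rightarrow> 'w \<Rightarrow> sample measure) \<Rightarrow> prediction_set \<Rightarrow> nat \<Rightarrow> real \<Rightarrow> real \<Rightarrow> 'w \<Rightarrow> real" where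
  "miscoverage \<kappa> PS n \<alpha> \<delta> \<omega> =
    measure (\<kappa> n \<omega>) {d \<in> space (\<kappa> n \<omega>).
      fst (d (n + 1)) \<notin> PS n \<alpha> \<delta> (restrict d {1..n}) (snd (d (n + 1)))}"

definition asymp_cond_conservative ::
    "'w measure \<Rightarrow> (nat \<Rightarrow> 'w \<Rightarrow> sample measure) \<Rightarrow> prediction_set \<Rightarrow> bool" where
  "asymp_cond_conservative M \<kappa> PS \<longleftrightarrow>
    (\<forall>\<delta>>0. \<forall>\<epsilon>>0.
      (\<lambda>n. measure M {\<omega> \<in> space M. (SUP \<alpha>\<in>{0..1}. miscoverage \<kappa> PS n \<alpha> \<delta> \<omega> - \<alpha>) \<ge> \<epsilon>})
        \<longlonglongrightarrow> 0)"

definition asymp_cond_valid ::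
    "'w measure \<Rightarrow> (nat \<Rightarrow> 'w \<Rightarrow> sample measure) \<Rightarrow> prediction_set \<Rightarrow> bool" where
  "asymp_cond_valid M \<kappa> PS \<longleftrightarrow>
    (\<lambda>n. \<integral>\<omega>. (SUP \<alpha>\<in>{0..1}. \<bar>miscoverage \<kappa> PS n \<alpha> 0 \<omega> - \<alpha>\<bar>) \<partial>M) \<longlonglongrightarrow> 0"

definition out_of_sample_stable ::
    "'w measure \<Rightarrow> (nat \<Rightarrow> nat \<Rightarrow> 'w \<Rightarrow> observation) \<Rightarrow> algorithm \<Rightarrow> bool" where
  "out_of_sample_stable M t A \<longleftrightarrow>
    (\<forall>\<epsilon>>0. (\<lambda>n. measure M {\<omega> \<in> space M.
        \<bar>A n n (snd (t n (n + 1) \<omega>)) (random_sample t n n \<omega>) -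
         A n (n - 1) (snd (t n (n + 1) \<omega>)) (drop_entry n n (random_sample t n n \<omega>))\<bar> \<ge> \<epsilon>})
        \<longlonglongrightarrow> 0)"

definition sup_norm :: "(real \<Rightarrow> real) \<Rightarrow> ennreal" where
  "sup_norm f = (SUP s. ennreal \<bar>f s\<bar>)"

text \<open>Stochastic boundedness is stated through events \<open>E\<close> of large probability, because the
  supremum norm of a density need not depend measurably on \<open>\<omega>\<close>, and \<open>measure\<close> is \<open>0\<close> on
  nonmeasurable sets. For measurable \<open>X n\<close> this is the usual notion (tightness).\<close>

definition stochastically_bounded :: "'w measure \<Rightarrow> (nat \<Rightarrow> 'w \<Rightarrow> ennreal) \<Rightarrow> bool" where
  "stochastically_bounded M X \<longleftrightarrow>
    (\<forall>\<epsilon>>0. \<exists>L::real. \<forall>n\<ge>1. \<exists>E\<in>sets M. measure M E \<ge> 1 - \<epsilon> \<and> (\<forall>\<omega>\<in>E. X n \<omega> \<le> ennreal L))"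

definition continuous_case ::
    "'w measure \<Rightarrow> (nat \<Rightarrow> nat \<Rightarrow> 'w \<Rightarrow> observation) \<Rightarrow> (nat \<Rightarrow> 'w \<Rightarrow> sample measure)
      \<Rightarrow> conformity_score \<Rightarrow> bool" where
  "continuous_case M t \<kappa> C \<longleftrightarrow>
    (\<exists>f :: nat \<Rightarrow> sample \<Rightarrow> real \<Rightarrow> real.
      (\<forall>n\<ge>1. AE \<omega> in M.
        (\<forall>s. f n (random_sample t n n \<omega>) s \<ge> 0) \<and>
        distributed (\<kappa> n \<omega>) lborel (\<lambda>d. C n n (d (n + 1)) (restrict d {1..n}))
          (\<lambda>s. ennreal (f n (random_sample t n n \<omega>) s))) \<and>
      stochastically_bounded M (\<lambda>n \<omega>. sup_norm (f n (random_sample t n n \<omega>))))"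

end

theory Submission
  imports Defs
begin

text \<open>The shortcut sets and the Jackknife are the same sets, written in two ways:
  \<open>\<bar>y - a\<bar> \<le> q + \<delta>\<close> says that \<open>y - a\<close> lies between \<open>- q - \<delta>\<close> and \<open>q + \<delta>\<close>.

  For the asymptotic equivalence, let \<open>y\<close> be the true response of the new observation. Full
  conformal prediction then compares the score of the last of \<open>n + 1\<close> i.i.d. observations with a
  quantile of all the scores obtained by leaving out one of the \<open>n + 1\<close> observations, the
  Jackknife with a quantile of the leave-one-out scores of the first \<open>n\<close> observations. The two
  scores of observation \<open>i\<close> differ at most by the distance of two predictions at its covariate,
  whose training samples differ by one observation. By exchangeability this distance is
  distributed like the one in the stability condition
  (\<open>gap_event_exchangeable\<close>), so with high probability it is small for all but a small fraction
  of the observations (\<open>integral_unstable_event_tendsto\<close>). Off the exceptional event, the two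
  empirical distribution functions agree up to a small shift of the argument and a small error
  (\<open>ecdf_comparison\<close>). Hence the miscoverage of either method is at most that of the other one at
  a slightly larger level and a slightly smaller inflation, up to the conditional probability of
  the exceptional event (\<open>miss_prob_le\<close>).

  For conservativity, the loss of inflation is harmless because every positive inflation is
  considered. For validity at inflation zero, the change of the inflation is undone in the
  Jackknife: its quantile depends on the training sample only, hence is almost surely constant
  under the conditional distribution (\<open>kernel_fixes_training\<close>), and the new score has a bounded
  conditional density, so a change of the inflation by \<open>\<eta>\<close> changes the miscoverage by at most a
  multiple of \<open>\<eta>\<close> (\<open>miss_prob_loo_inflation\<close>). The expected suprema for the two methods
  therefore have a difference that tends to zero (\<open>integral_deviation_diff_tendsto\<close>).\<close>

section \<open>Miscoverage as exceedance of an empirical quantile\<close>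

text \<open>Failure to be covered is the existence of a point of the superlevel set of \<open>F\<close> to the left
  of the deflated score. This form holds for infinite quantiles as well, and no quantile occurs
  in it.\<close>

lemma not_le_quantile_add_iff:
  "\<not> ereal u \<le> quantile F a + ereal \<delta> \<longleftrightarrow> (\<exists>s<u - \<delta>. F s \<ge> a)"
proof -
  have "\<not> ereal u \<le> quantile F a + ereal \<delta> \<longleftrightarrow> quantile F a < ereal (u - \<delta>)"
    by (cases "quantile F a") auto
  also have "\<dots> \<longleftrightarrow> (\<exists>s<u - \<delta>. F s \<ge> a)"
    unfolding quantile_def Inf_less_iff by auto
  finally show ?thesis .
qed

lemma PS_sc_eq_PI_sJ: "PS_sc Y (score_out A) n \<alpha> \<delta> T x = PI_sJ Y A n \<alpha> \<delta> T x"
proof -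
  have cdf: "sc_cdf (score_out A) n T =
      (\<lambda>s. 1 / real n * (\<Sum>i=1..n. of_bool (\<bar>loo_residual A n T i\<bar> \<le> s)))"
    by (simp add: fun_eq_iff sc_cdf_def score_out_def loo_residual_def)
  have "ereal \<bar>u\<bar> \<le> q + ereal \<delta> \<longleftrightarrow> ereal u \<in> {- q - ereal \<delta> .. q + ereal \<delta>}" for u q
    by (cases q) auto
  then show ?thesis
    unfolding PS_sc_def PI_sJ_def sJ_quantile_def cdf score_out_def by simp
qed

text \<open>Scores computed from an augmented sample \<open>d\<close> of size \<open>n + 1\<close>: the full conformal score
  of entry \<open>i\<close>, trained on the other \<open>n\<close> entries; the leave-one-out score, trained on the entries
  other than \<open>i\<close> among the first \<open>n\<close>; and the distance of the two predictions that they use. The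
  leave-one-out score is meant for \<open>i \<le> n\<close>; for \<open>i = n + 1\<close>, \<open>drop_entry n\<close> keeps the first
  \<open>n - 1\<close> entries, and so the last distance is the one that the stability condition controls.\<close>

definition fc_score :: "algorithm \<Rightarrow> nat \<Rightarrow> nat \<Rightarrow> sample \<Rightarrow> real" where
  "fc_score A n i d = \<bar>fst (d i) - A n n (snd (d i)) (drop_entry (n + 1) i d)\<bar>"

definition loo_score :: "algorithm \<Rightarrow> nat \<Rightarrow> nat \<Rightarrow> sample \<Rightarrow> real" where
  "loo_score A n i d = \<bar>fst (d i) - A n (n - 1) (snd (d i)) (drop_entry n i d)\<bar>"

definition prediction_gap :: "algorithm \<Rightarrow> nat \<Rightarrow> nat \<Rightarrow> sample \<Rightarrow> real" where
  "prediction_gap A n i d =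
    \<bar>A n n (snd (d i)) (drop_entry (n + 1) i d) - A n (n - 1) (snd (d i)) (drop_entry n i d)\<bar>"

lemma fc_loo_score_diff: "\<bar>fc_score A n i d - loo_score A n i d\<bar> \<le> prediction_gap A n i d"
  unfolding fc_score_def loo_score_def prediction_gap_def by arith

definition fc_ecdf :: "algorithm \<Rightarrow> nat \<Rightarrow> sample \<Rightarrow> real \<Rightarrow> real" where
  "fc_ecdf A n d s = 1 / (real n + 1) * (\<Sum>i=1..n + 1. of_bool (fc_score A n i d \<le> s))"

definition loo_ecdf :: "algorithm \<Rightarrow> nat \<Rightarrow> sample \<Rightarrow> real \<Rightarrow> real" where
  "loo_ecdf A n d s = 1 / real n * (\<Sum>i=1..n. of_bool (loo_score A n i d \<le> s))"

text \<open>The event that the score of entry \<open>n + 1\<close> exceeds the \<open>(1 - \<alpha>)\<close>-quantile of \<open>F\<close> by more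
  than \<open>\<delta>\<close>, for either empirical distribution function \<open>F\<close>.\<close>

definition misses ::
    "(algorithm \<Rightarrow> nat \<Rightarrow> sample \<Rightarrow> real \<Rightarrow> real) \<Rightarrow> algorithm \<Rightarrow> nat \<Rightarrow> real \<Rightarrow> real \<Rightarrow> sample \<Rightarrow> bool"
  where
  "misses F A n \<alpha> \<delta> d \<longleftrightarrow> (\<exists>s<fc_score A n (n + 1) d - \<delta>. F A n d s \<ge> 1 - \<alpha>)"

lemma misses_mono: "misses F A n \<alpha> \<delta> d \<Longrightarrow> \<alpha> \<le> \<beta> \<Longrightarrow> misses F A n \<beta> \<delta> d"
  unfolding misses_def by force

lemma fc_ecdf_mono: "s \<le> s' \<Longrightarrow> fc_ecdf A n d s \<le> fc_ecdf A n d s'"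
  unfolding fc_ecdf_def by (intro mult_left_mono sum_mono) auto

lemma loo_ecdf_mono: "s \<le> s' \<Longrightarrow> loo_ecdf A n d s \<le> loo_ecdf A n d s'"
  unfolding loo_ecdf_def by (intro mult_left_mono sum_mono) auto

text \<open>The leave-one-out scores of the first \<open>n\<close> entries do not see entry \<open>n + 1\<close>.\<close>

lemma drop_entry_restrict: "drop_entry n i (restrict d {1..n}) = drop_entry n i d"
  by (auto simp: drop_entry_def fun_eq_iff)

lemma drop_last_entry: "drop_entry (n + 1) (n + 1) d = restrict d {1..n}"
  by (auto simp: drop_entry_def fun_eq_iff)

lemma loo_score_restrict: "i \<in> {1..n} \<Longrightarrow> loo_score A n i (restrict d {1..n}) = loo_score A n i d"
  using drop_entry_restrict[of n i d] by (simp add: loo_score_def)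

lemma loo_ecdf_restrict: "loo_ecdf A n (restrict d {1..n}) = loo_ecdf A n d"
  unfolding loo_ecdf_def fun_eq_iff
  by (intro allI arg_cong[where f="(*) (1 / real n)"] sum.cong[OF refl])
    (simp only: loo_score_restrict)

text \<open>For an augmented sample, the two prediction sets fail to contain the last response exactly
  when \<^const>\<open>misses\<close> holds for the corresponding empirical distribution function.\<close>

context
  fixes Y :: "nat \<Rightarrow> real set" and n :: nat and d :: sample
  assumes extensional: "d \<in> extensional {1..n + 1}" and response: "fst (d (n + 1)) \<in> Y n"
begin

lemma fc_covers_iff:
  "fst (d (n + 1)) \<notin> PS_fc Y (score_out A) n \<alpha> \<delta> (restrict d {1..n}) (snd (d (n + 1)))
    \<longleftrightarrow> misses fc_ecdf A n \<alpha> \<delta> d"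
proof -
  let ?T = "restrict d {1..n}"
  have d_eq: "?T(n + 1 := d (n + 1)) = d"
    using extensional by (auto simp: fun_eq_iff extensional_def)
  have score: "score_out A n n (d (n + 1)) ?T = fc_score A n (n + 1) d"
    unfolding score_out_def fc_score_def drop_last_entry ..
  have "fc_cdf (score_out A) n ?T (snd (d (n + 1))) (fst (d (n + 1))) s = fc_ecdf A n d s" for s
  proof -
    have "(\<Sum>i=1..n. of_bool (score_out A n n (?T i) (drop_entry (n + 1) i d) \<le> s)) =
        (\<Sum>i=1..n. of_bool (fc_score A n i d \<le> s) :: real)"
      by (intro sum.cong refl) (simp only: score_out_def fc_score_def restrict_apply')
    then show ?thesis
      unfolding fc_cdf_def prod.collapse d_eq score fc_ecdf_def by (simp add: distrib_left)
  qed
  then have "fc_cdf (score_out A) n ?T (snd (d (n + 1))) (fst (d (n + 1))) = fc_ecdf A n d" ..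
  then show ?thesis
    using response score
    by (simp add: PS_fc_def misses_def not_le_quantile_add_iff)
qed

lemma sJ_covers_iff:
  "fst (d (n + 1)) \<notin> PI_sJ Y A n \<alpha> \<delta> (restrict d {1..n}) (snd (d (n + 1)))
    \<longleftrightarrow> misses loo_ecdf A n \<alpha> \<delta> d"
proof -
  let ?T = "restrict d {1..n}"
  have score: "score_out A n n (d (n + 1)) ?T = fc_score A n (n + 1) d"
    unfolding score_out_def fc_score_def drop_last_entry ..
  have "sc_cdf (score_out A) n ?T = loo_ecdf A n ?T"
    by (simp add: fun_eq_iff sc_cdf_def loo_ecdf_def loo_score_def score_out_def)
  then have "sc_cdf (score_out A) n ?T = loo_ecdf A n d"
    by (simp only: loo_ecdf_restrict)
  then show ?thesis
    using response score unfolding PS_sc_eq_PI_sJ[symmetric]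
    by (simp add: PS_sc_def misses_def not_le_quantile_add_iff)
qed

end

section \<open>Comparison of the two empirical distribution functions\<close>

text \<open>Among the first \<open>n\<close> entries, a fraction of at least \<open>\<theta>\<close> has a prediction gap of at least
  \<open>\<eta>\<close>.\<close>

definition unstable :: "algorithm \<Rightarrow> nat \<Rightarrow> real \<Rightarrow> real \<Rightarrow> sample \<Rightarrow> bool" where
  "unstable A n \<eta> \<theta> d \<longleftrightarrow> real n * \<theta> \<le> (\<Sum>i=1..n. of_bool (\<eta> \<le> prediction_gap A n i d))"

text \<open>Off this event the two empirical distribution functions agree up to a shift \<open>\<eta>\<close> of the
  argument and an error \<open>\<theta> + 1 / n\<close>; the \<open>1 / n\<close> pays for the last entry, which only the full
  conformal one counts, and for the different normalizations.\<close>

lemma ecdf_comparison: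
  assumes "n \<ge> 1" and "\<not> unstable A n \<eta> \<theta> d"
  shows fc_ecdf_le: "fc_ecdf A n d s \<le> loo_ecdf A n d (s + \<eta>) + (\<theta> + 1 / real n)"
    and loo_ecdf_le: "loo_ecdf A n d s \<le> fc_ecdf A n d (s + \<eta>) + (\<theta> + 1 / real n)"
proof -
  define a b :: "real \<Rightarrow> real" where
    "a s = (\<Sum>i=1..n. of_bool (fc_score A n i d \<le> s))" and
    "b s = (\<Sum>i=1..n. of_bool (loo_score A n i d \<le> s))" for s
  define g :: real where "g = (\<Sum>i=1..n. of_bool (\<eta> \<le> prediction_gap A n i d))"
  have g: "g \<le> real n * \<theta>"
    using assms(2) by (simp add: unstable_def g_def)
  have "of_bool (fc_score A n i d \<le> s) \<le>
      (of_bool (loo_score A n i d \<le> s + \<eta>) + of_bool (\<eta> \<le> prediction_gap A n i d) :: real)" for i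
    using fc_loo_score_diff[of A n i d] by auto
  then have ab: "a s \<le> b (s + \<eta>) + g"
    unfolding a_def b_def g_def sum.distrib[symmetric] by (intro sum_mono)
  have "of_bool (loo_score A n i d \<le> s) \<le>
      (of_bool (fc_score A n i d \<le> s + \<eta>) + of_bool (\<eta> \<le> prediction_gap A n i d) :: real)" for i
    using fc_loo_score_diff[of A n i d] by auto
  then have ba: "b s \<le> a (s + \<eta>) + g"
    unfolding a_def b_def g_def sum.distrib[symmetric] by (intro sum_mono)
  define c where "c s = (of_bool (fc_score A n (n + 1) d \<le> s) :: real)" for s
  have c: "0 \<le> c s" "c s \<le> 1" for s by (auto simp: c_def)
  have F: "fc_ecdf A n d s = (a s + c s) / (real n + 1)" for s
    by (simp add: fc_ecdf_def a_def c_def)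
  have G: "loo_ecdf A n d s = b s / real n" for s
    by (simp add: loo_ecdf_def b_def)
  have nn: "a s \<ge> 0" "b s \<ge> 0" "a s \<le> real n" for s
    using sum_bounded_above[of "{1..n}" "\<lambda>i. of_bool (fc_score A n i d \<le> s)" "1::real"]
    unfolding a_def b_def by (auto intro!: sum_nonneg)
  have n: "real n > 0" using assms(1) by simp
  have "(a s + c s) / (real n + 1) \<le> (b (s + \<eta>) + real n * \<theta> + 1) / (real n + 1)"
    using ab g c by (intro divide_right_mono) (auto intro: add_mono order_trans)
  also have "\<dots> \<le> (b (s + \<eta>) + real n * \<theta> + 1) / real n"
    using nn(2)[of "s + \<eta>"] g n sum_nonneg[of "{1..n}" "\<lambda>i. of_bool (\<eta> \<le> prediction_gap A n i d) :: real"]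
    by (intro divide_left_mono) (auto simp: g_def)
  also have "\<dots> = b (s + \<eta>) / real n + (\<theta> + 1 / real n)"
    using n by (simp add: field_simps)
  finally show "fc_ecdf A n d s \<le> loo_ecdf A n d (s + \<eta>) + (\<theta> + 1 / real n)"
    unfolding F G .
  have "b s / real n \<le> (a (s + \<eta>) + real n * \<theta>) / real n"
    using ba g n by (intro divide_right_mono) auto
  also have "\<dots> = a (s + \<eta>) / real n + \<theta>"
    using n by (simp add: field_simps)
  also have "a (s + \<eta>) / real n = (a (s + \<eta>) + a (s + \<eta>) / real n) / (real n + 1)"
  proof -
    have "a (s + \<eta>) + a (s + \<eta>) / real n = a (s + \<eta>) / real n * (real n + 1)"
      using n by (simp add: field_simps)
    then show ?thesis using n by simp
  qed
  also have "\<dots> \<le> (a (s + \<eta>) + 1) / (real n + 1)"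
    using n nn(3)[of "s + \<eta>"] by (intro divide_right_mono) auto
  also have "\<dots> \<le> a (s + \<eta>) / (real n + 1) + 1 / real n"
    using n by (simp add: add_divide_distrib frac_le)
  also have "a (s + \<eta>) / (real n + 1) \<le> (a (s + \<eta>) + c (s + \<eta>)) / (real n + 1)"
    using c by (intro divide_right_mono) auto
  finally show "loo_ecdf A n d s \<le> fc_ecdf A n d (s + \<eta>) + (\<theta> + 1 / real n)"
    unfolding F G by simp
qed

lemma misses_comparison:
  assumes "n \<ge> 1" and "\<not> unstable A n \<eta> \<theta> d"
  shows fc_misses_imp_loo:
      "misses fc_ecdf A n \<alpha> \<delta> d \<Longrightarrow> misses loo_ecdf A n (\<alpha> + (\<theta> + 1 / real n)) (\<delta> - \<eta>) d"
    and loo_misses_imp_fc: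
      "misses loo_ecdf A n \<alpha> \<delta> d \<Longrightarrow> misses fc_ecdf A n (\<alpha> + (\<theta> + 1 / real n)) (\<delta> - \<eta>) d"
proof -
  show "misses loo_ecdf A n (\<alpha> + (\<theta> + 1 / real n)) (\<delta> - \<eta>) d" if miss: "misses fc_ecdf A n \<alpha> \<delta> d"
  proof -
    obtain s where "s < fc_score A n (n + 1) d - \<delta>" "fc_ecdf A n d s \<ge> 1 - \<alpha>"
      using miss by (auto simp: misses_def)
    then show ?thesis
      using fc_ecdf_le[OF assms, of s] unfolding misses_def by (intro exI[of _ "s + \<eta>"]) auto
  qed
  show "misses fc_ecdf A n (\<alpha> + (\<theta> + 1 / real n)) (\<delta> - \<eta>) d" if miss: "misses loo_ecdf A n \<alpha> \<delta> d"
  proof -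
    obtain s where "s < fc_score A n (n + 1) d - \<delta>" "loo_ecdf A n d s \<ge> 1 - \<alpha>"
      using miss by (auto simp: misses_def)
    then show ?thesis
      using loo_ecdf_le[OF assms, of s] unfolding misses_def by (intro exI[of _ "s + \<eta>"]) auto
  qed
qed

section \<open>Suprema over the level\<close>

text \<open>For a monotone \<open>h\<close>, a level can be replaced by a slightly larger rational one to bound
  \<open>h \<alpha> - \<alpha>\<close>, and by a slightly smaller one to bound \<open>\<alpha> - h \<alpha>\<close>. This makes the suprema over
  the level measurable.\<close>

lemma SUP_rational_level:
  fixes h :: "real \<Rightarrow> real"
  assumes mono: "\<And>\<alpha> \<beta>. \<alpha> \<le> \<beta> \<Longrightarrow> h \<alpha> \<le> h \<beta>" and range: "\<And>\<alpha>. h \<alpha> \<in> {0..1}"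
  shows "(SUP \<alpha>\<in>{0..1}. h \<alpha> - \<alpha>) = (SUP \<alpha>\<in>{0..1} \<inter> \<rat>. h \<alpha> - \<alpha>)"
    and "(SUP \<alpha>\<in>{0..1}. \<bar>h \<alpha> - \<alpha>\<bar>) = (SUP \<alpha>\<in>{0..1} \<inter> \<rat>. \<bar>h \<alpha> - \<alpha>\<bar>)"
proof -
  have "0 \<in> {0..1::real} \<inter> \<rat>" by simp
  then have ne: "{0..1::real} \<inter> \<rat> \<noteq> {}" by blast
  have bdd1: "bdd_above ((\<lambda>\<alpha>. h \<alpha> - \<alpha>) ` S)" if "S \<subseteq> {0..1}" for S
  proof (intro bdd_aboveI2[where M=1])
    fix \<alpha> assume "\<alpha> \<in> S"
    then show "h \<alpha> - \<alpha> \<le> 1" using range[of \<alpha>] that by (auto simp: subset_eq)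
  qed
  have bdd2: "bdd_above ((\<lambda>\<alpha>. \<bar>h \<alpha> - \<alpha>\<bar>) ` S)" if "S \<subseteq> {0..1}" for S
  proof (intro bdd_aboveI2[where M=1])
    fix \<alpha> assume "\<alpha> \<in> S"
    then show "\<bar>h \<alpha> - \<alpha>\<bar> \<le> 1" using range[of \<alpha>] that by (auto simp: subset_eq abs_le_iff)
  qed
  have up: "\<exists>r\<in>{0..1} \<inter> \<rat>. h \<alpha> - \<alpha> \<le> h r - r + e" if \<alpha>: "\<alpha> \<in> {0..1}" and e: "e > 0" for \<alpha> e
  proof (cases "\<alpha> = 1")
    case True
    then show ?thesis using \<alpha> e by (intro bexI[of _ 1]) auto
  next
    case False
    then obtain r where r: "r \<in> \<rat>" "\<alpha> < r" "r < min 1 (\<alpha> + e)"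
      using Rats_dense_in_real[of \<alpha> "min 1 (\<alpha> + e)"] \<alpha> e by auto
    then show ?thesis using mono[of \<alpha> r] \<alpha> e by (intro bexI[of _ r]) auto
  qed
  have low: "\<exists>r\<in>{0..1} \<inter> \<rat>. \<alpha> - h \<alpha> \<le> r - h r + e" if \<alpha>: "\<alpha> \<in> {0..1}" and e: "e > 0" for \<alpha> e
  proof (cases "\<alpha> = 0")
    case True
    then show ?thesis using \<alpha> e by (intro bexI[of _ 0]) auto
  next
    case False
    then obtain r where r: "r \<in> \<rat>" "max 0 (\<alpha> - e) < r" "r < \<alpha>"
      using Rats_dense_in_real[of "max 0 (\<alpha> - e)" \<alpha>] \<alpha> e by auto
    then show ?thesis using mono[of r \<alpha>] \<alpha> e by (intro bexI[of _ r]) auto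
  qed
  show "(SUP \<alpha>\<in>{0..1}. h \<alpha> - \<alpha>) = (SUP \<alpha>\<in>{0..1} \<inter> \<rat>. h \<alpha> - \<alpha>)"
  proof (intro antisym cSUP_least)
    fix \<alpha> :: real assume \<alpha>: "\<alpha> \<in> {0..1}"
    show "h \<alpha> - \<alpha> \<le> (SUP \<alpha>\<in>{0..1} \<inter> \<rat>. h \<alpha> - \<alpha>)"
    proof (rule field_le_epsilon)
      fix e :: real assume "e > 0"
      then obtain r where "r \<in> {0..1} \<inter> \<rat>" "h \<alpha> - \<alpha> \<le> h r - r + e" using up \<alpha> by blast
      then show "h \<alpha> - \<alpha> \<le> (SUP \<alpha>\<in>{0..1} \<inter> \<rat>. h \<alpha> - \<alpha>) + e"
        using cSUP_upper[of r "{0..1} \<inter> \<rat>" "\<lambda>\<alpha>. h \<alpha> - \<alpha>", OF _ bdd1] by auto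
    qed
  qed (use ne in \<open>auto intro!: cSUP_upper bdd1\<close>)
  show "(SUP \<alpha>\<in>{0..1}. \<bar>h \<alpha> - \<alpha>\<bar>) = (SUP \<alpha>\<in>{0..1} \<inter> \<rat>. \<bar>h \<alpha> - \<alpha>\<bar>)"
  proof (intro antisym cSUP_least)
    fix \<alpha> :: real assume \<alpha>: "\<alpha> \<in> {0..1}"
    show "\<bar>h \<alpha> - \<alpha>\<bar> \<le> (SUP \<alpha>\<in>{0..1} \<inter> \<rat>. \<bar>h \<alpha> - \<alpha>\<bar>)"
    proof (rule field_le_epsilon)
      fix e :: real assume e: "e > 0"
      obtain r where "r \<in> {0..1} \<inter> \<rat>" "\<bar>h \<alpha> - \<alpha>\<bar> \<le> \<bar>h r - r\<bar> + e"
      proof (cases "h \<alpha> \<ge> \<alpha>")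
        case True
        then show ?thesis using up[OF \<alpha> e] that by fastforce
      next
        case False
        then show ?thesis using low[OF \<alpha> e] that by fastforce
      qed
      then show "\<bar>h \<alpha> - \<alpha>\<bar> \<le> (SUP \<alpha>\<in>{0..1} \<inter> \<rat>. \<bar>h \<alpha> - \<alpha>\<bar>) + e"
        using cSUP_upper[of r "{0..1} \<inter> \<rat>" "\<lambda>\<alpha>. \<bar>h \<alpha> - \<alpha>\<bar>", OF _ bdd2] by auto
    qed
  qed (use ne in \<open>auto intro!: cSUP_upper bdd2\<close>)
qed

text \<open>A shift \<open>\<tau>\<close> of the level that leaves the unit interval costs at most \<open>\<tau>\<close>, because
  \<open>h - \<alpha> \<le> 1 - \<alpha>\<close> and \<open>\<alpha> - h \<le> \<alpha>\<close>.\<close>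

lemma SUP_level_shift:
  fixes h k :: "real \<Rightarrow> real"
  assumes h: "\<And>\<alpha>. h \<alpha> \<in> {0..1}" and k: "\<And>\<alpha>. k \<alpha> \<in> {0..1}" and "\<tau> \<ge> 0" "b \<ge> 0"
    and up: "\<And>\<alpha>. h \<alpha> \<le> k (\<alpha> + \<tau>) + b"
  shows "(SUP \<alpha>\<in>{0..1}. h \<alpha> - \<alpha>) \<le> (SUP \<alpha>\<in>{0..1}. k \<alpha> - \<alpha>) + \<tau> + b"
proof (rule cSUP_least)
  fix \<alpha> :: real assume \<alpha>: "\<alpha> \<in> {0..1}"
  have bdd: "bdd_above ((\<lambda>\<alpha>. k \<alpha> - \<alpha>) ` {0..1})"
  proof (intro bdd_aboveI2[where M=1])
    fix \<alpha> :: real assume "\<alpha> \<in> {0..1}"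
    then show "k \<alpha> - \<alpha> \<le> 1" using k[of \<alpha>] by auto
  qed
  note upper = cSUP_upper[OF _ bdd]
  have "0 \<le> (SUP \<alpha>\<in>{0..1}. k \<alpha> - \<alpha>)"
    using upper[of 0] k[of 0] by auto
  then show "h \<alpha> - \<alpha> \<le> (SUP \<alpha>\<in>{0..1}. k \<alpha> - \<alpha>) + \<tau> + b"
    using up[of \<alpha>] upper[of "\<alpha> + \<tau>"] h[of \<alpha>] \<alpha> assms(3,4) by (cases "\<alpha> + \<tau> \<le> 1") auto
qed simp

lemma SUP_abs_level_shift:
  fixes h k :: "real \<Rightarrow> real"
  assumes h: "\<And>\<alpha>. h \<alpha> \<in> {0..1}" and k: "\<And>\<alpha>. k \<alpha> \<in> {0..1}" and "\<tau> \<ge> 0" "b \<ge> 0"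
    and up: "\<And>\<alpha>. h \<alpha> \<le> k (\<alpha> + \<tau>) + b" and low: "\<And>\<alpha>. k \<alpha> \<le> h (\<alpha> + \<tau>) + b"
  shows "(SUP \<alpha>\<in>{0..1}. \<bar>h \<alpha> - \<alpha>\<bar>) \<le> (SUP \<alpha>\<in>{0..1}. \<bar>k \<alpha> - \<alpha>\<bar>) + \<tau> + b"
proof (rule cSUP_least)
  fix \<alpha> :: real assume \<alpha>: "\<alpha> \<in> {0..1}"
  have bdd: "bdd_above ((\<lambda>\<alpha>. \<bar>k \<alpha> - \<alpha>\<bar>) ` {0..1})"
  proof (intro bdd_aboveI2[where M=1])
    fix \<alpha> :: real assume "\<alpha> \<in> {0..1}"
    then show "\<bar>k \<alpha> - \<alpha>\<bar> \<le> 1" using k[of \<alpha>] by (auto simp: abs_le_iff)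
  qed
  note upper = cSUP_upper[OF _ bdd]
  have nonneg: "0 \<le> (SUP \<alpha>\<in>{0..1}. \<bar>k \<alpha> - \<alpha>\<bar>)"
    using upper[of 0] by auto
  have "h \<alpha> - \<alpha> \<le> (SUP \<alpha>\<in>{0..1}. \<bar>k \<alpha> - \<alpha>\<bar>) + \<tau> + b"
    using nonneg up[of \<alpha>] upper[of "\<alpha> + \<tau>"] h[of \<alpha>] \<alpha> assms(3,4)
    by (cases "\<alpha> + \<tau> \<le> 1") (auto simp: abs_le_iff)
  moreover have "\<alpha> - h \<alpha> \<le> (SUP \<alpha>\<in>{0..1}. \<bar>k \<alpha> - \<alpha>\<bar>) + \<tau> + b"
    using nonneg low[of "\<alpha> - \<tau>"] upper[of "\<alpha> - \<tau>"] h[of \<alpha>] \<alpha> assms(3,4)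
    by (cases "\<alpha> - \<tau> \<ge> 0") (auto simp: abs_le_iff)
  ultimately show "\<bar>h \<alpha> - \<alpha>\<bar> \<le> (SUP \<alpha>\<in>{0..1}. \<bar>k \<alpha> - \<alpha>\<bar>) + \<tau> + b"
    by (auto simp: abs_le_iff)
qed simp

section \<open>Measurability\<close>

lemma measurable_response: "fst \<in> borel_measurable (observation_space R k)"
  unfolding observation_space_def
  by (rule measurable_compose[OF measurable_fst]) (simp add: measurable_restrict_space1)

lemma measurable_covariate: "snd \<in> observation_space R k \<rightarrow>\<^sub>M covariate_space k"
  unfolding observation_space_def by simp

lemma measurable_entry:
  "i \<in> {1..m} \<Longrightarrow> (\<lambda>d. d i) \<in> sample_space R k m \<rightarrow>\<^sub>M observation_space R k"
  unfolding sample_space_def by (rule measurable_component_singleton)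

lemma measurable_drop_entry:
  assumes "m \<le> m'"
  shows "drop_entry m i \<in> sample_space R k m' \<rightarrow>\<^sub>M sample_space R k (m - 1)"
proof -
  have "(\<lambda>d. \<lambda>j\<in>{1..m - 1}. if j < i then d j else d (Suc j))
      \<in> sample_space R k m' \<rightarrow>\<^sub>M (\<Pi>\<^sub>M j\<in>{1..m - 1}. observation_space R k)"
  proof (rule measurable_restrict)
    fix j assume "j \<in> {1..m - 1}"
    then show "(\<lambda>d. if j < i then d j else d (Suc j))
        \<in> sample_space R k m' \<rightarrow>\<^sub>M observation_space R k"
      using assms by (cases "j < i") (auto intro!: measurable_entry)
  qed
  then show ?thesis
    unfolding drop_entry_def sample_space_def[of R k "m - 1"] .
qed

lemma measurable_restrict_sample:
  "m \<le> m' \<Longrightarrow> (\<lambda>d. restrict d {1..m}) \<in> sample_space R k m' \<rightarrow>\<^sub>M sample_space R k m"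
  unfolding sample_space_def by (rule measurable_restrict_subset) auto

text \<open>A triangular array whose \<open>n\<close>-th row is an i.i.d. sample of size \<open>n + 1\<close>, together with its
  conditional distribution given the first \<open>n\<close> observations, and a prediction algorithm.\<close>

locale iid_prediction = prob_space M
  for M :: "'w measure" +
  fixes Y :: "nat \<Rightarrow> real set"
    and p :: "nat \<Rightarrow> nat"
    and P :: "nat \<Rightarrow> observation measure"
    and t :: "nat \<Rightarrow> nat \<Rightarrow> 'w \<Rightarrow> observation"
    and \<kappa> :: "nat \<Rightarrow> 'w \<Rightarrow> sample measure"
    and A :: algorithm
  assumes prob_P: "\<And>n. n \<ge> 1 \<Longrightarrow> prob_space (P n)"
    and sets_P: "\<And>n. n \<ge> 1 \<Longrightarrow> sets (P n) = sets (observation_space (Y n) (p n))"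
    and indep: "\<And>n. n \<ge> 1 \<Longrightarrow> indep_vars (\<lambda>i. observation_space (Y n) (p n)) (t n) {1..n + 1}"
    and ident: "\<And>n i. n \<ge> 1 \<Longrightarrow> i \<in> {1..n + 1} \<Longrightarrow>
      distr M (observation_space (Y n) (p n)) (t n i) = P n"
    and kernel: "\<And>n. n \<ge> 1 \<Longrightarrow>
      regular_cond_distr M (training_algebra M Y p t n)
        (sample_space (Y n) (p n) (n + 1)) (random_sample t n (n + 1)) (\<kappa> n)"
    and algorithm: "prediction_algorithm Y p A"
begin

text \<open>The measurable space of samples of size \<open>n + 1\<close>, on which the kernel \<open>\<kappa> n\<close> lives.\<close>

definition augmented_space :: "nat \<Rightarrow> sample measure" where
  "augmented_space n = sample_space (Y n) (p n) (n + 1)"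

lemma augmented_spaceD:
  assumes "d \<in> space (augmented_space n)"
  shows "d \<in> extensional {1..n + 1}" and "fst (d (n + 1)) \<in> Y n"
proof -
  have d: "d \<in> {1..n + 1} \<rightarrow>\<^sub>E Y n \<times> space (covariate_space (p n))"
    using assms
    by (simp add: augmented_space_def sample_space_def space_PiM observation_space_def space_pair_measure
        space_restrict_space)
  show "d \<in> extensional {1..n + 1}" using d by (simp add: PiE_iff)
  have "d (n + 1) \<in> Y n \<times> space (covariate_space (p n))"
    using d by (rule PiE_mem) simp
  then show "fst (d (n + 1)) \<in> Y n" by auto
qed

lemma measurable_prediction:
  assumes "n \<ge> 1" "i \<in> {1..k}" "Suc m \<le> k"
  shows "(\<lambda>d. A n m (snd (d i)) (drop_entry (Suc m) i d))
    \<in> borel_measurable (sample_space (Y n) (p n) k)"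
proof -
  have "(\<lambda>d. (snd (d i), drop_entry (Suc m) i d))
      \<in> sample_space (Y n) (p n) k
        \<rightarrow>\<^sub>M covariate_space (p n) \<Otimes>\<^sub>M sample_space (Y n) (p n) m"
    using measurable_compose[OF measurable_entry[OF assms(2)] measurable_covariate]
      measurable_drop_entry[OF assms(3)] by (intro measurable_Pair) auto
  moreover have "(\<lambda>(x, T). A n m x T)
      \<in> borel_measurable (covariate_space (p n) \<Otimes>\<^sub>M sample_space (Y n) (p n) m)"
    using algorithm assms(1) unfolding prediction_algorithm_def
    by (auto intro: measurable_compose simp: measurable_restrict_space2_iff)
  ultimately show ?thesis
    using measurable_compose by fastforce
qed

lemma measurable_scores:
  assumes "n \<ge> 1" "i \<in> {1..n + 1}"
  shows measurable_fc_score: "fc_score A n i \<in> borel_measurable (augmented_space n)"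
    and measurable_loo_score: "loo_score A n i \<in> borel_measurable (augmented_space n)"
    and measurable_prediction_gap: "prediction_gap A n i \<in> borel_measurable (augmented_space n)"
proof -
  have [measurable]: "(\<lambda>d. fst (d i)) \<in> borel_measurable (augmented_space n)"
    unfolding augmented_space_def by (rule measurable_compose[OF measurable_entry[OF assms(2)] measurable_response])
  have [measurable]:
      "(\<lambda>d. A n n (snd (d i)) (drop_entry (n + 1) i d)) \<in> borel_measurable (augmented_space n)"
      "(\<lambda>d. A n (n - 1) (snd (d i)) (drop_entry n i d)) \<in> borel_measurable (augmented_space n)"
    using measurable_prediction[OF assms, of n] measurable_prediction[OF assms, of "n - 1"] assms(1)
    unfolding augmented_space_def by simp_all
  show "fc_score A n i \<in> borel_measurable (augmented_space n)" "loo_score A n i \<in> borel_measurable (augmented_space n)"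
      "prediction_gap A n i \<in> borel_measurable (augmented_space n)"
    unfolding fc_score_def[abs_def] loo_score_def[abs_def] prediction_gap_def[abs_def] by measurable
qed

lemma measurable_ecdf:
  assumes "n \<ge> 1" and F: "F \<in> {fc_ecdf, loo_ecdf}"
  shows "(\<lambda>d. F A n d s) \<in> borel_measurable (augmented_space n)"
proof -
  have "(\<lambda>d. fc_ecdf A n d s) \<in> borel_measurable (augmented_space n)"
    unfolding fc_ecdf_def
    by (intro borel_measurable_times borel_measurable_sum borel_measurable_const)
      (use measurable_fc_score[OF assms(1)] in measurable)
  moreover have "(\<lambda>d. loo_ecdf A n d s) \<in> borel_measurable (augmented_space n)"
    unfolding loo_ecdf_def
    by (intro borel_measurable_times borel_measurable_sum borel_measurable_const)
      (use measurable_loo_score[OF assms(1)] in measurable)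
  ultimately show ?thesis using F by auto
qed

definition miss_event ::
    "(algorithm \<Rightarrow> nat \<Rightarrow> sample \<Rightarrow> real \<Rightarrow> real) \<Rightarrow> nat \<Rightarrow> real \<Rightarrow> real \<Rightarrow> sample set" where
  "miss_event F n \<alpha> \<delta> = {d \<in> space (augmented_space n). misses F A n \<alpha> \<delta> d}"

definition unstable_event :: "nat \<Rightarrow> real \<Rightarrow> real \<Rightarrow> sample set" where
  "unstable_event n \<eta> \<theta> = {d \<in> space (augmented_space n). unstable A n \<eta> \<theta> d}"

text \<open>By monotonicity of \<open>F\<close>, the witness in \<^const>\<open>misses\<close> can be taken rational.\<close>

lemma miss_event_measurable:
  assumes n: "n \<ge> 1" and F: "F \<in> {fc_ecdf, loo_ecdf}"
  shows "miss_event F n \<alpha> \<delta> \<in> sets (augmented_space n)"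
proof -
  have mono: "F A n d s \<le> F A n d s'" if "s \<le> s'" for d s s'
    using F that fc_ecdf_mono loo_ecdf_mono by auto
  have "misses F A n \<alpha> \<delta> d \<longleftrightarrow>
      (\<exists>q::rat. of_rat q < fc_score A n (n + 1) d - \<delta> \<and> F A n d (of_rat q) \<ge> 1 - \<alpha>)" for d
  proof
    assume "misses F A n \<alpha> \<delta> d"
    then obtain s where s: "s < fc_score A n (n + 1) d - \<delta>" "F A n d s \<ge> 1 - \<alpha>"
      by (auto simp: misses_def)
    then obtain q where "s < of_rat q" "of_rat q < fc_score A n (n + 1) d - \<delta>"
      using of_rat_dense by blast
    then show "\<exists>q::rat. of_rat q < fc_score A n (n + 1) d - \<delta> \<and> F A n d (of_rat q) \<ge> 1 - \<alpha>"
      using s mono[of s "of_rat q" d] by (intro exI[of _ q]) auto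
  qed (auto simp: misses_def)
  moreover have [measurable]: "fc_score A n (n + 1) \<in> borel_measurable (augmented_space n)"
    using n by (intro measurable_fc_score) auto
  note [measurable] = measurable_ecdf[OF n F]
  have "{d \<in> space (augmented_space n). \<exists>q::rat. of_rat q < fc_score A n (n + 1) d - \<delta> \<and> F A n d (of_rat q) \<ge> 1 - \<alpha>}
      \<in> sets (augmented_space n)"
    by measurable
  ultimately show ?thesis unfolding miss_event_def by simp
qed

lemma gap_event_measurable:
  assumes "n \<ge> 1" "i \<in> {1..n + 1}"
  shows "{d \<in> space (augmented_space n). \<eta> \<le> prediction_gap A n i d} \<in> sets (augmented_space n)"
  using measurable_prediction_gap[OF assms] by measurable

lemma unstable_event_measurable:
  assumes n: "n \<ge> 1"
  shows "unstable_event n \<eta> \<theta> \<in> sets (augmented_space n)"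
proof -
  have [measurable]:
      "(\<lambda>d. \<Sum>i=1..n. of_bool (\<eta> \<le> prediction_gap A n i d) :: real) \<in> borel_measurable (augmented_space n)"
    by (intro borel_measurable_sum) (use measurable_prediction_gap[OF n] in measurable)
  show ?thesis
    unfolding unstable_event_def unstable_def by measurable
qed

section \<open>The conditional distribution of the augmented sample\<close>

lemma measurable_observation:
  "n \<ge> 1 \<Longrightarrow> i \<in> {1..n + 1} \<Longrightarrow> t n i \<in> M \<rightarrow>\<^sub>M observation_space (Y n) (p n)"
  using indep[of n] unfolding indep_vars_def by auto

lemma measurable_random_sample:
  assumes "n \<ge> 1" "m \<le> n + 1"
  shows "random_sample t n m \<in> M \<rightarrow>\<^sub>M sample_space (Y n) (p n) m"
  unfolding random_sample_def[abs_def] sample_space_def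
  by (rule measurable_restrict) (use assms in \<open>auto intro!: measurable_observation\<close>)

lemma subalgebra_training: "n \<ge> 1 \<Longrightarrow> subalgebra M (training_algebra M Y p t n)"
  unfolding subalgebra_def training_algebra_def
  using sets_image_in_sets[OF refl measurable_random_sample[of n n]] by simp

lemma measurable_kernel: "n \<ge> 1 \<Longrightarrow> \<kappa> n \<in> M \<rightarrow>\<^sub>M prob_algebra (augmented_space n)"
  using kernel[of n] measurable_from_subalg[OF subalgebra_training]
  unfolding regular_cond_distr_def augmented_space_def by blast

lemma kernel_at:
  assumes "n \<ge> 1" "\<omega> \<in> space M"
  shows prob_space_kernel: "prob_space (\<kappa> n \<omega>)"
    and sets_kernel: "sets (\<kappa> n \<omega>) = sets (augmented_space n)"
    and space_kernel: "space (\<kappa> n \<omega>) = space (augmented_space n)"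
proof -
  have "\<kappa> n \<omega> \<in> space (prob_algebra (augmented_space n))"
    using measurable_space[OF measurable_kernel[OF assms(1)] assms(2)] .
  then show "prob_space (\<kappa> n \<omega>)" and sets: "sets (\<kappa> n \<omega>) = sets (augmented_space n)"
    by (auto simp: space_prob_algebra)
  show "space (\<kappa> n \<omega>) = space (augmented_space n)"
    using sets by (rule sets_eq_imp_space_eq)
qed

lemma measurable_measure_kernel:
  "n \<ge> 1 \<Longrightarrow> B \<in> sets (augmented_space n) \<Longrightarrow> (\<lambda>\<omega>. measure (\<kappa> n \<omega>) B) \<in> borel_measurable M"
  by (rule measurable_compose[OF measurable_kernel measurable_measure_prob_algebra])

lemma measure_kernel_range:
  "n \<ge> 1 \<Longrightarrow> \<omega> \<in> space M \<Longrightarrow> measure (\<kappa> n \<omega>) B \<in> {0..1}"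
  using prob_space.prob_le_1[OF prob_space_kernel] by auto

lemma integrable_measure_kernel:
  assumes "n \<ge> 1" "B \<in> sets (augmented_space n)"
  shows "integrable M (\<lambda>\<omega>. measure (\<kappa> n \<omega>) B)"
  using measure_kernel_range[OF assms(1)]
  by (intro integrable_const_bound[where B=1] measurable_measure_kernel assms) auto

lemma integral_measure_kernel:
  assumes n: "n \<ge> 1" and B: "B \<in> sets (augmented_space n)"
  shows "(\<integral>\<omega>. measure (\<kappa> n \<omega>) B \<partial>M) = measure (distr M (augmented_space n) (random_sample t n (n + 1))) B"
proof -
  interpret F: finite_measure_subalgebra M "training_algebra M Y p t n"
    by unfold_locales (rule subalgebra_training[OF n])
  have D: "random_sample t n (n + 1) \<in> M \<rightarrow>\<^sub>M augmented_space n"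
    using measurable_random_sample[OF n] unfolding augmented_space_def by simp
  let ?B = "random_sample t n (n + 1) -` B \<inter> space M"
  have B': "?B \<in> events" using D B by (rule measurable_sets)
  have "AE \<omega> in M. measure (\<kappa> n \<omega>) B =
      real_cond_exp M (training_algebra M Y p t n) (indicator ?B) \<omega>"
    using kernel[OF n] B unfolding regular_cond_distr_def augmented_space_def by blast
  then have "(\<integral>\<omega>. measure (\<kappa> n \<omega>) B \<partial>M) =
      (\<integral>\<omega>. real_cond_exp M (training_algebra M Y p t n) (indicator ?B) \<omega> \<partial>M)"
    by (intro integral_cong_AE measurable_measure_kernel n B) auto
  also have "\<dots> = (\<integral>\<omega>. indicator ?B \<omega> \<partial>M)"
    using B' by (intro F.real_cond_exp_int(2)) (auto simp: emeasure_eq_measure)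
  also have "\<dots> = measure M ?B"
    using B' by simp
  finally show ?thesis
    using D B by (simp add: measure_distr)
qed

text \<open>Under \<open>\<kappa> n \<omega>\<close>, every random variable that depends on the training sample only is almost
  surely constant.\<close>

lemma kernel_fixes_training:
  assumes n: "n \<ge> 1" and h: "h \<in> borel_measurable (sample_space (Y n) (p n) n)"
  shows "AE \<omega> in M. AE d in \<kappa> n \<omega>. h (restrict d {1..n}) = (h (random_sample t n n \<omega>) :: real)"
proof -
  interpret F: finite_measure_subalgebra M "training_algebra M Y p t n"
    by unfold_locales (rule subalgebra_training[OF n])
  define D where "D = random_sample t n (n + 1)"
  have D: "D \<in> M \<rightarrow>\<^sub>M augmented_space n"
    using measurable_random_sample[OF n] unfolding augmented_space_def D_def by simp
  have res: "restrict (D \<omega>) {1..n} = random_sample t n n \<omega>" for \<omega>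
    by (auto simp: D_def random_sample_def fun_eq_iff)
  define B where "B q = {d \<in> space (augmented_space n). h (restrict d {1..n}) \<le> of_rat q}" for q
  have hr: "(\<lambda>d. h (restrict d {1..n})) \<in> borel_measurable (augmented_space n)"
    unfolding augmented_space_def by (rule measurable_compose[OF measurable_restrict_sample h]) simp
  have B: "B q \<in> sets (augmented_space n)" for q
    unfolding B_def using hr by measurable
  have vimage: "D -` B q \<inter> space M = {\<omega> \<in> space M. h (random_sample t n n \<omega>) \<le> of_rat q}" for q
    using measurable_space[OF D] res unfolding B_def by (auto simp del: One_nat_def)
  have "AE \<omega> in M. measure (\<kappa> n \<omega>) (B q) = indicator (D -` B q \<inter> space M) \<omega>" for q
  proof -
    have "random_sample t n n \<in> training_algebra M Y p t n \<rightarrow>\<^sub>M sample_space (Y n) (p n) n"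
      unfolding training_algebra_def
      using measurable_space[OF measurable_random_sample[OF n, of n]]
      by (intro measurable_vimage_algebra1) auto
    from measurable_compose[OF this h]
    have "{\<omega> \<in> space (training_algebra M Y p t n). h (random_sample t n n \<omega>) \<le> of_rat q}
        \<in> sets (training_algebra M Y p t n)"
      by measurable
    then have "D -` B q \<inter> space M \<in> sets (training_algebra M Y p t n)"
      unfolding vimage by (simp add: training_algebra_def)
    then have "AE \<omega> in M. real_cond_exp M (training_algebra M Y p t n)
        (indicator (D -` B q \<inter> space M)) \<omega> = indicator (D -` B q \<inter> space M) \<omega>"
      using measurable_sets[OF D B] by (intro F.real_cond_exp_F_meas) (auto simp: emeasure_eq_measure)
    moreover have "AE \<omega> in M. measure (\<kappa> n \<omega>) (B q) =
        real_cond_exp M (training_algebra M Y p t n) (indicator (D -` B q \<inter> space M)) \<omega>"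
      using kernel[OF n] B[of q] unfolding regular_cond_distr_def augmented_space_def D_def by blast
    ultimately show ?thesis by eventually_elim simp
  qed
  then have "AE \<omega> in M. \<forall>q. measure (\<kappa> n \<omega>) (B q) = indicator (D -` B q \<inter> space M) \<omega>"
    by (simp add: AE_all_countable)
  with AE_space show ?thesis
  proof eventually_elim
    case (elim \<omega>)
    interpret K: prob_space "\<kappa> n \<omega>" by (rule prob_space_kernel[OF n elim(1)])
    have BK: "B q \<in> K.events" for q using B sets_kernel[OF n elim(1)] by simp
    have "AE d in \<kappa> n \<omega>. h (restrict d {1..n}) \<le> of_rat q \<longleftrightarrow> h (random_sample t n n \<omega>) \<le> of_rat q"
      for q
    proof (cases "h (random_sample t n n \<omega>) \<le> of_rat q")
      case True
      then have "K.prob (B q) = 1" using elim vimage by simp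
      then have "AE d in \<kappa> n \<omega>. d \<in> B q" by (rule K.AE_prob_1)
      then show ?thesis by eventually_elim (use True in \<open>auto simp: B_def\<close>)
    next
      case False
      then have "K.prob (B q) = 0" using elim vimage by simp
      then have "AE d in \<kappa> n \<omega>. d \<notin> B q" using BK[of q] by (simp add: K.prob_eq_0)
      with AE_space show ?thesis
        by eventually_elim (use False space_kernel[OF n elim(1)] in \<open>auto simp: B_def\<close>)
    qed
    then have "AE d in \<kappa> n \<omega>. \<forall>q. h (restrict d {1..n}) \<le> of_rat q \<longleftrightarrow>
        h (random_sample t n n \<omega>) \<le> of_rat q"
      by (simp add: AE_all_countable)
    then show ?case
    proof eventually_elim
      case (elim d)
      show ?case
      proof (rule ccontr)
        assume "h (restrict d {1..n}) \<noteq> h (random_sample t n n \<omega>)"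
        then consider "h (restrict d {1..n}) < h (random_sample t n n \<omega>)"
          | "h (random_sample t n n \<omega>) < h (restrict d {1..n})" by linarith
        then show False
        proof cases
          case 1
          then obtain q where "h (restrict d {1..n}) < of_rat q" "of_rat q < h (random_sample t n n \<omega>)"
            using of_rat_dense by blast
          with elim show False by (meson less_le_not_le)
        next
          case 2
          then obtain q where "h (random_sample t n n \<omega>) < of_rat q" "of_rat q < h (restrict d {1..n})"
            using of_rat_dense by blast
          with elim show False by (meson less_le_not_le)
        qed
      qed
    qed
  qed
qed

section \<open>Exchangeability and stability\<close>

text \<open>Moving entry \<open>i\<close> to the end turns the prediction gap of entry \<open>i\<close> into that of the last
  entry, and leaves the law of an i.i.d. sample invariant.\<close>

lemma gap_event_exchangeable:
  assumes n: "n \<ge> 1" and i: "i \<in> {1..n + 1}"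
  defines "Q \<equiv> distr M (augmented_space n) (random_sample t n (n + 1))"
  shows "measure Q {d \<in> space (augmented_space n). \<eta> \<le> prediction_gap A n i d} =
    measure Q {d \<in> space (augmented_space n). \<eta> \<le> prediction_gap A n (n + 1) d}"
proof -
  \<comment> \<open>The rearranged sample consists of the entries other than \<open>i\<close> in their order, then entry
    \<open>i\<close>. For \<open>i \<le> n\<close>, entry \<open>n + 1\<close> is thus in position \<open>n\<close>, and the first \<open>n - 1\<close> positions
    are the training sample of the leave-one-out score of entry \<open>i\<close>.\<close>
  define f where "f j = (if j = n + 1 then i else if j < i then j else Suc j)" for j
  define c :: "sample \<Rightarrow> sample" where "c d = (\<lambda>j\<in>{1..n + 1}. d (f j))" for d
  have "Q = (\<Pi>\<^sub>M j\<in>{1..n + 1}. distr M (observation_space (Y n) (p n)) (t n j))"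
    using iffD1[OF indep_vars_iff_distr_eq_PiM' indep[OF n]] measurable_observation[OF n]
    unfolding Q_def augmented_space_def sample_space_def random_sample_def[abs_def] by simp
  also have "\<dots> = (\<Pi>\<^sub>M j\<in>{1..n + 1}. P n)"
    using ident[OF n] by (intro PiM_cong) auto
  finally have Q: "Q = (\<Pi>\<^sub>M j\<in>{1..n + 1}. P n)" .
  have sets_Q: "sets Q = sets (augmented_space n)" by (simp add: Q_def)
  have f: "inj_on f {1..n + 1}" "f \<in> {1..n + 1} \<rightarrow> {1..n + 1}"
    using i by (auto simp: f_def inj_on_def split: if_splits)
  have "distr Q Q c = Q"
    using distr_PiM_reindex[OF _ f, of "\<lambda>_. P n"] prob_P[OF n]
    unfolding Q c_def[abs_def] by simp
  moreover have c: "c \<in> Q \<rightarrow>\<^sub>M Q"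
    unfolding Q c_def[abs_def] using f(2)
    by (intro measurable_restrict measurable_component_singleton) auto
  let ?E = "{d \<in> space (augmented_space n). \<eta> \<le> prediction_gap A n (n + 1) d}"
  have E: "?E \<in> sets Q"
    unfolding sets_Q using n by (intro gap_event_measurable) auto
  have sp: "space Q = space (augmented_space n)" using sets_Q by (rule sets_eq_imp_space_eq)
  have gap: "prediction_gap A n (n + 1) (c d) = prediction_gap A n i d" for d
  proof -
    have "c d (n + 1) = d i" by (simp add: c_def f_def)
    moreover have "drop_entry (n + 1) (n + 1) (c d) = drop_entry (n + 1) i d"
      by (auto simp: drop_entry_def c_def f_def fun_eq_iff)
    moreover have "drop_entry n (n + 1) (c d) = drop_entry n i d"
      by (auto simp: drop_entry_def c_def f_def fun_eq_iff)
    ultimately show ?thesis by (simp add: prediction_gap_def)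
  qed
  have "c -` ?E \<inter> space Q = {d \<in> space (augmented_space n). \<eta> \<le> prediction_gap A n i d}"
    using measurable_space[OF c] unfolding sp vimage_def Int_def mem_Collect_eq gap by auto
  then show ?thesis
    using measure_distr[OF c E] \<open>distr Q Q c = Q\<close> by simp
qed

text \<open>By Markov's inequality, the expected fraction of entries with a large prediction gap
  bounds the probability that this fraction is large; by exchangeability it is the probability
  that the stability condition controls.\<close>

lemma integral_unstable_event_le:
  assumes n: "n \<ge> 1" and "\<theta> > 0"
  shows "(\<integral>\<omega>. measure (\<kappa> n \<omega>) (unstable_event n \<eta> \<theta>) \<partial>M) \<le>
    measure M {\<omega> \<in> space M. \<eta> \<le> \<bar>A n n (snd (t n (n + 1) \<omega>)) (random_sample t n n \<omega>) -
      A n (n - 1) (snd (t n (n + 1) \<omega>)) (drop_entry n n (random_sample t n n \<omega>))\<bar>} / \<theta>"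
proof -
  define D where "D = random_sample t n (n + 1)"
  have D: "D \<in> M \<rightarrow>\<^sub>M augmented_space n"
    using measurable_random_sample[OF n] unfolding augmented_space_def D_def by simp
  define Q where "Q = distr M (augmented_space n) D"
  interpret Q: prob_space Q unfolding Q_def using D by (rule prob_space_distr)
  define g where "g i = {d \<in> space (augmented_space n). \<eta> \<le> prediction_gap A n i d}" for i
  have g: "g i \<in> Q.events" if "i \<in> {1..n + 1}" for i
    unfolding g_def Q_def sets_distr by (rule gap_event_measurable[OF n that])
  have U: "unstable_event n \<eta> \<theta> \<in> Q.events"
    unfolding Q_def sets_distr by (rule unstable_event_measurable[OF n])
  have "real n * \<theta> * Q.prob (unstable_event n \<eta> \<theta>) =
      (\<integral>d. real n * \<theta> * indicator (unstable_event n \<eta> \<theta>) d \<partial>Q)"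
    using U by simp
  also have "\<dots> \<le> (\<integral>d. (\<Sum>i=1..n. indicator (g i) d) \<partial>Q)"
  proof (rule integral_mono_AE)
    show "integrable Q (\<lambda>d. \<Sum>i=1..n. indicator (g i) d :: real)"
      using g by (intro Bochner_Integration.integrable_sum integrable_real_indicator)
        (auto simp: Q.emeasure_eq_measure)
    show "AE d in Q. real n * \<theta> * indicator (unstable_event n \<eta> \<theta>) d \<le> (\<Sum>i=1..n. indicator (g i) d)"
    proof (rule AE_I2)
      fix d assume "d \<in> space Q"
      then have ind: "indicator (g i) d = (of_bool (\<eta> \<le> prediction_gap A n i d) :: real)" for i
        by (simp add: g_def Q_def indicator_def)
      show "real n * \<theta> * indicator (unstable_event n \<eta> \<theta>) d \<le> (\<Sum>i=1..n. indicator (g i) d)"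
        unfolding ind unstable_event_def unstable_def
        by (cases "real n * \<theta> \<le> (\<Sum>i=1..n. of_bool (\<eta> \<le> prediction_gap A n i d))")
          (auto simp: indicator_def sum_nonneg simp del: sum_of_bool_eq)
    qed
  qed (use U in \<open>auto simp: Q.emeasure_eq_measure\<close>)
  also have "\<dots> = (\<Sum>i=1..n. Q.prob (g i))"
    using g by (subst Bochner_Integration.integral_sum) (auto simp: Q.emeasure_eq_measure)
  also have "\<dots> = (\<Sum>i=1..n. Q.prob (g (n + 1)))"
    unfolding g_def Q_def D_def using n by (intro sum.cong refl gap_event_exchangeable) auto
  also have "\<dots> = real n * Q.prob (g (n + 1))" by simp
  also have "Q.prob (g (n + 1)) = measure M (D -` g (n + 1) \<inter> space M)"
    unfolding Q_def using D g[of "n + 1"] by (intro measure_distr) (auto simp: Q_def)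
  also have "D -` g (n + 1) \<inter> space M = {\<omega> \<in> space M. \<eta> \<le>
      \<bar>A n n (snd (t n (n + 1) \<omega>)) (random_sample t n n \<omega>) -
       A n (n - 1) (snd (t n (n + 1) \<omega>)) (drop_entry n n (random_sample t n n \<omega>))\<bar>}"
  proof -
    have "D \<omega> (n + 1) = t n (n + 1) \<omega>" for \<omega> by (simp add: D_def random_sample_def)
    moreover have "drop_entry (n + 1) (n + 1) (D \<omega>) = random_sample t n n \<omega>" for \<omega>
      by (auto simp: D_def random_sample_def drop_entry_def fun_eq_iff)
    moreover have "drop_entry n (n + 1) (D \<omega>) = drop_entry n n (random_sample t n n \<omega>)" for \<omega>
      by (auto simp: D_def random_sample_def drop_entry_def fun_eq_iff)
    ultimately have "prediction_gap A n (n + 1) (D \<omega>) =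
        \<bar>A n n (snd (t n (n + 1) \<omega>)) (random_sample t n n \<omega>) -
         A n (n - 1) (snd (t n (n + 1) \<omega>)) (drop_entry n n (random_sample t n n \<omega>))\<bar>" for \<omega>
      by (simp add: prediction_gap_def)
    then show ?thesis using measurable_space[OF D] unfolding g_def by auto
  qed
  finally have "\<theta> * Q.prob (unstable_event n \<eta> \<theta>) \<le> measure M {\<omega> \<in> space M. \<eta> \<le>
      \<bar>A n n (snd (t n (n + 1) \<omega>)) (random_sample t n n \<omega>) -
       A n (n - 1) (snd (t n (n + 1) \<omega>)) (drop_entry n n (random_sample t n n \<omega>))\<bar>}"
    using n by simp
  moreover have "(\<integral>\<omega>. measure (\<kappa> n \<omega>) (unstable_event n \<eta> \<theta>) \<partial>M) = Q.prob (unstable_event n \<eta> \<theta>)"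
    unfolding Q_def D_def by (rule integral_measure_kernel[OF n unstable_event_measurable[OF n]])
  ultimately show ?thesis
    using assms(2) by (simp add: field_simps)
qed

lemma integral_unstable_event_tendsto:
  assumes stable: "out_of_sample_stable M t A" and "\<eta> > 0" "\<theta> > 0"
  shows "(\<lambda>n. \<integral>\<omega>. measure (\<kappa> n \<omega>) (unstable_event n \<eta> \<theta>) \<partial>M) \<longlonglongrightarrow> 0"
proof (rule tendsto_sandwich[OF _ _ tendsto_const])
  show "\<forall>\<^sub>F n in sequentially. 0 \<le> (\<integral>\<omega>. measure (\<kappa> n \<omega>) (unstable_event n \<eta> \<theta>) \<partial>M)"
    by (simp add: integral_nonneg_AE)
  show "\<forall>\<^sub>F n in sequentially. (\<integral>\<omega>. measure (\<kappa> n \<omega>) (unstable_event n \<eta> \<theta>) \<partial>M) \<le>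
    measure M {\<omega> \<in> space M. \<eta> \<le> \<bar>A n n (snd (t n (n + 1) \<omega>)) (random_sample t n n \<omega>) -
      A n (n - 1) (snd (t n (n + 1) \<omega>)) (drop_entry n n (random_sample t n n \<omega>))\<bar>} / \<theta>"
    using eventually_ge_at_top[of 1] by eventually_elim (rule integral_unstable_event_le[OF _ assms(3)])
  have "(\<lambda>n. measure M {\<omega> \<in> space M. \<eta> \<le> \<bar>A n n (snd (t n (n + 1) \<omega>)) (random_sample t n n \<omega>) -
      A n (n - 1) (snd (t n (n + 1) \<omega>)) (drop_entry n n (random_sample t n n \<omega>))\<bar>}) \<longlonglongrightarrow> 0"
    using stable assms(2) unfolding out_of_sample_stable_def by blast
  from tendsto_divide[OF this tendsto_const[of \<theta>]] assms(3)
  show "(\<lambda>n. measure M {\<omega> \<in> space M. \<eta> \<le> \<bar>A n n (snd (t n (n + 1) \<omega>)) (random_sample t n n \<omega>) -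
      A n (n - 1) (snd (t n (n + 1) \<omega>)) (drop_entry n n (random_sample t n n \<omega>))\<bar>} / \<theta>) \<longlonglongrightarrow> 0"
    by simp
qed

section \<open>Conditional miscoverage of the two methods\<close>

text \<open>The conditional miscoverage at level \<open>\<alpha>\<close> with inflation \<open>\<delta>\<close>: of the full conformal sets
  for \<open>F = fc_ecdf\<close>, of the symmetrized Jackknife for \<open>F = loo_ecdf\<close>.\<close>

definition miss_prob ::
    "(algorithm \<Rightarrow> nat \<Rightarrow> sample \<Rightarrow> real \<Rightarrow> real) \<Rightarrow> nat \<Rightarrow> real \<Rightarrow> real \<Rightarrow> 'w \<Rightarrow> real" where
  "miss_prob F n \<alpha> \<delta> \<omega> = measure (\<kappa> n \<omega>) (miss_event F n \<alpha> \<delta>)"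

lemma miscoverage_eq:
  assumes "n \<ge> 1" "\<omega> \<in> space M"
  shows miscoverage_fc:
      "miscoverage \<kappa> (PS_fc Y (score_out A)) n \<alpha> \<delta> \<omega> = miss_prob fc_ecdf n \<alpha> \<delta> \<omega>"
    and miscoverage_sJ: "miscoverage \<kappa> (PI_sJ Y A) n \<alpha> \<delta> \<omega> = miss_prob loo_ecdf n \<alpha> \<delta> \<omega>"
proof -
  note iffs = fc_covers_iff[where Y=Y, OF augmented_spaceD] sJ_covers_iff[where Y=Y, OF augmented_spaceD]
  show "miscoverage \<kappa> (PS_fc Y (score_out A)) n \<alpha> \<delta> \<omega> = miss_prob fc_ecdf n \<alpha> \<delta> \<omega>"
      "miscoverage \<kappa> (PI_sJ Y A) n \<alpha> \<delta> \<omega> = miss_prob loo_ecdf n \<alpha> \<delta> \<omega>"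
    unfolding miscoverage_def miss_prob_def miss_event_def space_kernel[OF assms]
    by (intro arg_cong[where f="measure (\<kappa> n \<omega>)"] Collect_cong conj_cong refl iffs; assumption)+
qed

lemma miss_prob_range: "n \<ge> 1 \<Longrightarrow> \<omega> \<in> space M \<Longrightarrow> miss_prob F n \<alpha> \<delta> \<omega> \<in> {0..1}"
  unfolding miss_prob_def by (rule measure_kernel_range)

lemma miss_prob_mono:
  assumes "n \<ge> 1" "\<omega> \<in> space M" "F \<in> {fc_ecdf, loo_ecdf}" "\<alpha> \<le> \<beta>"
  shows "miss_prob F n \<alpha> \<delta> \<omega> \<le> miss_prob F n \<beta> \<delta> \<omega>"
proof -
  interpret K: prob_space "\<kappa> n \<omega>" by (rule prob_space_kernel[OF assms(1,2)])
  show ?thesis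
    unfolding miss_prob_def
    using miss_event_measurable[OF assms(1,3)] sets_kernel[OF assms(1,2)] misses_mono assms(4)
    by (intro K.finite_measure_mono) (auto simp: miss_event_def)
qed

lemma measurable_miss_prob:
  "n \<ge> 1 \<Longrightarrow> F \<in> {fc_ecdf, loo_ecdf} \<Longrightarrow> miss_prob F n \<alpha> \<delta> \<in> borel_measurable M"
  unfolding miss_prob_def[abs_def] by (intro measurable_measure_kernel miss_event_measurable)

text \<open>The quantities that conservativity and validity are about: the largest excess of the
  conditional miscoverage over the level, and, without inflation, the largest deviation.\<close>

definition excess ::
    "(algorithm \<Rightarrow> nat \<Rightarrow> sample \<Rightarrow> real \<Rightarrow> real) \<Rightarrow> nat \<Rightarrow> real \<Rightarrow> 'w \<Rightarrow> real" where
  "excess F n \<delta> \<omega> = (SUP \<alpha>\<in>{0..1}. miss_prob F n \<alpha> \<delta> \<omega> - \<alpha>)"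

definition deviation ::
    "(algorithm \<Rightarrow> nat \<Rightarrow> sample \<Rightarrow> real \<Rightarrow> real) \<Rightarrow> nat \<Rightarrow> 'w \<Rightarrow> real" where
  "deviation F n \<omega> = (SUP \<alpha>\<in>{0..1}. \<bar>miss_prob F n \<alpha> 0 \<omega> - \<alpha>\<bar>)"

lemma deviation_range:
  assumes "n \<ge> 1" "\<omega> \<in> space M"
  shows "deviation F n \<omega> \<in> {0..1}"
proof -
  have le: "\<bar>miss_prob F n \<alpha> 0 \<omega> - \<alpha>\<bar> \<le> 1" if "\<alpha> \<in> {0..1}" for \<alpha>
    using miss_prob_range[OF assms, of F \<alpha> 0] that by (auto simp: abs_le_iff)
  have "0 \<le> \<bar>miss_prob F n 0 0 \<omega> - 0\<bar>" by simp
  also have "\<dots> \<le> deviation F n \<omega>"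
    unfolding deviation_def using le by (intro cSUP_upper bdd_aboveI2[where M=1]) auto
  finally have "0 \<le> deviation F n \<omega>" .
  moreover have "deviation F n \<omega> \<le> 1"
    unfolding deviation_def using le by (intro cSUP_least) auto
  ultimately show ?thesis by simp
qed

lemma measurable_suprema:
  assumes n: "n \<ge> 1" and F: "F \<in> {fc_ecdf, loo_ecdf}"
  shows measurable_excess: "excess F n \<delta> \<in> borel_measurable M"
    and measurable_deviation: "deviation F n \<in> borel_measurable M"
proof -
  note [measurable] = measurable_miss_prob[OF n F]
  have count: "countable ({0..1} \<inter> \<rat> :: real set)"
    using countable_rat by (rule countable_subset[rotated]) auto
  have "excess F n \<delta> \<omega> = (SUP \<alpha>\<in>{0..1} \<inter> \<rat>. miss_prob F n \<alpha> \<delta> \<omega> - \<alpha>)" if "\<omega> \<in> space M" for \<omega>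
    unfolding excess_def using miss_prob_mono[OF n that F] miss_prob_range[OF n that]
    by (rule SUP_rational_level(1))
  moreover have "(\<lambda>\<omega>. SUP \<alpha>\<in>{0..1} \<inter> \<rat>. miss_prob F n \<alpha> \<delta> \<omega> - \<alpha>) \<in> borel_measurable M"
  proof (intro borel_measurable_cSUP count bdd_aboveI2[where M=1])
    fix \<omega> \<alpha> assume "\<omega> \<in> space M" "\<alpha> \<in> {0..1::real} \<inter> \<rat>"
    then show "miss_prob F n \<alpha> \<delta> \<omega> - \<alpha> \<le> 1"
      using miss_prob_range[OF n, of \<omega> F \<alpha> \<delta>] by auto
  qed measurable
  ultimately show "excess F n \<delta> \<in> borel_measurable M"
    by (subst measurable_cong)
  have "deviation F n \<omega> = (SUP \<alpha>\<in>{0..1} \<inter> \<rat>. \<bar>miss_prob F n \<alpha> 0 \<omega> - \<alpha>\<bar>)" if "\<omega> \<in> space M" for \<omega>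
    unfolding deviation_def using miss_prob_mono[OF n that F] miss_prob_range[OF n that]
    by (rule SUP_rational_level(2))
  moreover have "(\<lambda>\<omega>. SUP \<alpha>\<in>{0..1} \<inter> \<rat>. \<bar>miss_prob F n \<alpha> 0 \<omega> - \<alpha>\<bar>) \<in> borel_measurable M"
  proof (intro borel_measurable_cSUP count bdd_aboveI2[where M=1])
    fix \<omega> \<alpha> assume "\<omega> \<in> space M" "\<alpha> \<in> {0..1::real} \<inter> \<rat>"
    then show "\<bar>miss_prob F n \<alpha> 0 \<omega> - \<alpha>\<bar> \<le> 1"
      using miss_prob_range[OF n, of \<omega> F \<alpha> 0] by (auto simp: abs_le_iff)
  qed measurable
  ultimately show "deviation F n \<in> borel_measurable M"
    by (subst measurable_cong)
qed

lemma integrable_deviation: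
  "n \<ge> 1 \<Longrightarrow> F \<in> {fc_ecdf, loo_ecdf} \<Longrightarrow> integrable M (deviation F n)"
  using deviation_range by (intro integrable_const_bound[where B=1] measurable_deviation) auto

text \<open>The conditional probability of the unstable event. Its integral tends to zero under
  stability.\<close>

definition unstable_prob :: "nat \<Rightarrow> real \<Rightarrow> real \<Rightarrow> 'w \<Rightarrow> real" where
  "unstable_prob n \<eta> \<theta> \<omega> = measure (\<kappa> n \<omega>) (unstable_event n \<eta> \<theta>)"

lemma unstable_prob_nonneg: "unstable_prob n \<eta> \<theta> \<omega> \<ge> 0"
  unfolding unstable_prob_def by simp

lemma integrable_unstable_prob: "n \<ge> 1 \<Longrightarrow> integrable M (unstable_prob n \<eta> \<theta>)"
  unfolding unstable_prob_def[abs_def]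
  by (intro integrable_measure_kernel unstable_event_measurable)

text \<open>Each method misses at most as often as the other one at a slightly larger level and a
  slightly smaller inflation, up to the probability of the unstable event.\<close>

lemma miss_prob_le:
  assumes n: "n \<ge> 1" and \<omega>: "\<omega> \<in> space M" and FG: "(F, G) \<in> {(fc_ecdf, loo_ecdf), (loo_ecdf, fc_ecdf)}"
  shows "miss_prob F n \<alpha> \<delta> \<omega> \<le>
    miss_prob G n (\<alpha> + (\<theta> + 1 / real n)) (\<delta> - \<eta>) \<omega> + unstable_prob n \<eta> \<theta> \<omega>"
proof -
  interpret K: prob_space "\<kappa> n \<omega>" by (rule prob_space_kernel[OF n \<omega>])
  let ?G = "miss_event G n (\<alpha> + (\<theta> + 1 / real n)) (\<delta> - \<eta>)"
  have G: "?G \<in> K.events" and U: "unstable_event n \<eta> \<theta> \<in> K.events"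
    using FG miss_event_measurable[OF n, of G] unstable_event_measurable[OF n] sets_kernel[OF n \<omega>]
    by auto
  have "miss_event F n \<alpha> \<delta> \<subseteq> ?G \<union> unstable_event n \<eta> \<theta>"
    using FG misses_comparison[OF n] by (auto simp: miss_event_def unstable_event_def)
  then have "K.prob (miss_event F n \<alpha> \<delta>) \<le> K.prob (?G \<union> unstable_event n \<eta> \<theta>)"
    using G U by (intro K.finite_measure_mono) auto
  also have "\<dots> \<le> K.prob ?G + K.prob (unstable_event n \<eta> \<theta>)"
    using G U by (rule measure_Un_le)
  finally show ?thesis unfolding miss_prob_def unstable_prob_def .
qed

section \<open>Conservativity\<close>

lemma asymp_cond_conservative_iff:
  assumes PS: "\<And>n \<omega> \<alpha> \<delta>. n \<ge> 1 \<Longrightarrow> \<omega> \<in> space M \<Longrightarrow> miscoverage \<kappa> PS n \<alpha> \<delta> \<omega> = miss_prob F n \<alpha> \<delta> \<omega>"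
  shows "asymp_cond_conservative M \<kappa> PS \<longleftrightarrow>
    (\<forall>\<delta>>0. \<forall>\<epsilon>>0. (\<lambda>n. prob {\<omega> \<in> space M. \<epsilon> \<le> excess F n \<delta> \<omega>}) \<longlonglongrightarrow> 0)"
proof -
  have "(\<lambda>n. prob {\<omega> \<in> space M. (SUP \<alpha>\<in>{0..1}. miscoverage \<kappa> PS n \<alpha> \<delta> \<omega> - \<alpha>) \<ge> \<epsilon>}) \<longlonglongrightarrow> 0
      \<longleftrightarrow> (\<lambda>n. prob {\<omega> \<in> space M. \<epsilon> \<le> excess F n \<delta> \<omega>}) \<longlonglongrightarrow> 0" for \<delta> \<epsilon>
  proof (rule filterlim_cong[OF refl refl])
    show "\<forall>\<^sub>F n in sequentially.
        prob {\<omega> \<in> space M. (SUP \<alpha>\<in>{0..1}. miscoverage \<kappa> PS n \<alpha> \<delta> \<omega> - \<alpha>) \<ge> \<epsilon>} =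
        prob {\<omega> \<in> space M. \<epsilon> \<le> excess F n \<delta> \<omega>}"
      using eventually_ge_at_top[of 1]
    proof eventually_elim
      case (elim n)
      have "(SUP \<alpha>\<in>{0..1}. miscoverage \<kappa> PS n \<alpha> \<delta> \<omega> - \<alpha>) = excess F n \<delta> \<omega>" if "\<omega> \<in> space M" for \<omega>
        unfolding excess_def PS[OF elim that] ..
      then show ?case by (intro arg_cong[where f=prob]) auto
    qed
  qed
  then show ?thesis unfolding asymp_cond_conservative_def by simp
qed

lemma conservative_transfer:
  assumes stable: "out_of_sample_stable M t A"
    and FG: "(F, G) \<in> {(fc_ecdf, loo_ecdf), (loo_ecdf, fc_ecdf)}"
    and G: "\<forall>\<delta>>0. \<forall>\<epsilon>>0. (\<lambda>n. prob {\<omega> \<in> space M. \<epsilon> \<le> excess G n \<delta> \<omega>}) \<longlonglongrightarrow> 0"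
  shows "\<forall>\<delta>>0. \<forall>\<epsilon>>0. (\<lambda>n. prob {\<omega> \<in> space M. \<epsilon> \<le> excess F n \<delta> \<omega>}) \<longlonglongrightarrow> 0"
proof (intro allI impI)
  fix \<delta> \<epsilon> :: real assume \<delta>: "\<delta> > 0" and \<epsilon>: "\<epsilon> > 0"
  \<comment> \<open>Half of the inflation absorbs the shift of the scores, a quarter of \<open>\<epsilon>\<close> the fraction of
    unstable entries.\<close>
  define \<eta> \<theta> where "\<eta> = \<delta> / 2" and "\<theta> = \<epsilon> / 4"
  have pos: "\<eta> > 0" "\<theta> > 0" using \<delta> \<epsilon> by (auto simp: \<eta>_def \<theta>_def)
  let ?u = "unstable_prob"
  show "(\<lambda>n. prob {\<omega> \<in> space M. \<epsilon> \<le> excess F n \<delta> \<omega>}) \<longlonglongrightarrow> 0"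
  proof (rule tendsto_sandwich[OF _ _ tendsto_const])
    show "\<forall>\<^sub>F n in sequentially. prob {\<omega> \<in> space M. \<epsilon> \<le> excess F n \<delta> \<omega>} \<le>
        prob {\<omega> \<in> space M. \<theta> \<le> excess G n \<eta> \<omega>} + (\<integral>\<omega>. ?u n \<eta> \<theta> \<omega> \<partial>M) / \<theta>"
      using eventually_ge_at_top[of "max 1 (nat \<lceil>1 / \<theta>\<rceil>)"]
    proof eventually_elim
      case (elim n)
      then have n: "n \<ge> 1" and "real n \<ge> 1 / \<theta>" by (auto simp: le_nat_iff ceiling_le_iff)
      then have n': "1 / real n \<le> \<theta>" using \<epsilon> by (auto simp: \<theta>_def field_simps)
      have GG: "G \<in> {fc_ecdf, loo_ecdf}" using FG by auto
      let ?E = "{\<omega> \<in> space M. \<theta> \<le> excess G n \<eta> \<omega>}" and ?U = "{\<omega> \<in> space M. \<theta> \<le> ?u n \<eta> \<theta> \<omega>}"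
      have E: "?E \<in> events" using measurable_excess[OF n GG] by measurable
      have U: "?U \<in> events"
        using borel_measurable_integrable[OF integrable_unstable_prob[OF n]] by measurable
      have "excess F n \<delta> \<omega> < \<epsilon>" if \<omega>: "\<omega> \<in> space M" and "excess G n \<eta> \<omega> < \<theta>" "?u n \<eta> \<theta> \<omega> < \<theta>" for \<omega>
      proof -
        have "excess F n \<delta> \<omega> \<le> excess G n (\<delta> - \<eta>) \<omega> + (\<theta> + 1 / real n) + ?u n \<eta> \<theta> \<omega>"
          unfolding excess_def using \<epsilon>
          by (intro SUP_level_shift miss_prob_range[OF n \<omega>] unstable_prob_nonneg
              miss_prob_le[OF n \<omega> FG]) (auto simp: \<theta>_def)
        then show ?thesis using that n' by (simp add: \<eta>_def \<theta>_def)
      qed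
      then have "{\<omega> \<in> space M. \<epsilon> \<le> excess F n \<delta> \<omega>} \<subseteq> ?E \<union> ?U"
        by force
      then have "prob {\<omega> \<in> space M. \<epsilon> \<le> excess F n \<delta> \<omega>} \<le> prob (?E \<union> ?U)"
        using E U by (intro finite_measure_mono) auto
      also have "\<dots> \<le> prob ?E + prob ?U" using E U by (rule measure_Un_le)
      also have "prob ?U \<le> (\<integral>\<omega>. ?u n \<eta> \<theta> \<omega> \<partial>M) / \<theta>"
        using integrable_unstable_prob[OF n] \<epsilon> unstable_prob_nonneg
        by (intro integral_Markov_inequality_measure[where A="{}"]) (auto simp: \<theta>_def)
      finally show ?case by simp
    qed
    have "(\<lambda>n. prob {\<omega> \<in> space M. \<theta> \<le> excess G n \<eta> \<omega>} + (\<integral>\<omega>. ?u n \<eta> \<theta> \<omega> \<partial>M) / \<theta>) \<longlonglongrightarrow> 0 + 0 / \<theta>"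
      using G pos integral_unstable_event_tendsto[OF stable pos]
      by (intro tendsto_add tendsto_divide tendsto_const) (auto simp: unstable_prob_def[abs_def])
    then show "(\<lambda>n. prob {\<omega> \<in> space M. \<theta> \<le> excess G n \<eta> \<omega>} + (\<integral>\<omega>. ?u n \<eta> \<theta> \<omega> \<partial>M) / \<theta>) \<longlonglongrightarrow> 0"
      by simp
  qed simp
qed

section \<open>Validity in the continuous case\<close>

text \<open>The quantile of the leave-one-out scores is a constant under the conditional distribution,
  so changing the inflation changes the miss event only where the score of the new observation
  lies in an interval whose length is the change.\<close>

lemma miss_prob_loo_inflation:
  assumes n: "n \<ge> 1" and \<omega>: "\<omega> \<in> space M" and "L \<ge> 0" and "\<delta>' \<le> \<delta>"
    and const: "AE d in \<kappa> n \<omega>. loo_ecdf A n d = H"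
    and dens: "distributed (\<kappa> n \<omega>) lborel (fc_score A n (n + 1)) (\<lambda>s. ennreal (f s))"
    and bound: "\<And>s. f s \<le> L"
  shows "miss_prob loo_ecdf n \<alpha> \<delta>' \<omega> \<le> miss_prob loo_ecdf n \<alpha> \<delta> \<omega> + L * (\<delta> - \<delta>')"
proof -
  interpret K: prob_space "\<kappa> n \<omega>" by (rule prob_space_kernel[OF n \<omega>])
  define q where "q = Inf {s. 1 - \<alpha> \<le> H s}"
  let ?J = "fc_score A n (n + 1) -` {q + \<delta>'..q + \<delta>} \<inter> space (\<kappa> n \<omega>)"
  have J: "?J \<in> K.events"
    using distributed_measurable[OF dens] by (rule measurable_sets) simp
  have miss: "miss_event loo_ecdf n \<alpha> \<delta> \<in> K.events"
    using miss_event_measurable[OF n] sets_kernel[OF n \<omega>] by simp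
  have "AE d in \<kappa> n \<omega>. d \<in> miss_event loo_ecdf n \<alpha> \<delta>' \<longrightarrow> d \<in> miss_event loo_ecdf n \<alpha> \<delta> \<union> ?J"
    using const
  proof eventually_elim
    case (elim d)
    let ?U = "fc_score A n (n + 1) d"
    have "?U \<in> {q + \<delta>'..q + \<delta>}"
      if d: "misses loo_ecdf A n \<alpha> \<delta>' d" "\<not> misses loo_ecdf A n \<alpha> \<delta> d"
    proof -
      obtain s where s: "s < ?U - \<delta>'" "1 - \<alpha> \<le> H s"
        using d(1) elim by (auto simp: misses_def)
      have lower: "?U - \<delta> \<le> r" if "1 - \<alpha> \<le> H r" for r
        using d(2) elim that by (force simp: misses_def)
      have "q \<le> s" unfolding q_def using s lower by (intro cInf_lower bdd_belowI) auto
      moreover have "?U - \<delta> \<le> q" unfolding q_def using s lower by (intro cInf_greatest) auto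
      ultimately show ?thesis using s by auto
    qed
    then show ?case using space_kernel[OF n \<omega>] by (auto simp: miss_event_def)
  qed
  then have "miss_prob loo_ecdf n \<alpha> \<delta>' \<omega> \<le> K.prob (miss_event loo_ecdf n \<alpha> \<delta> \<union> ?J)"
    unfolding miss_prob_def using miss J by (intro K.finite_measure_mono_AE) auto
  also have "\<dots> \<le> miss_prob loo_ecdf n \<alpha> \<delta> \<omega> + K.prob ?J"
    unfolding miss_prob_def using miss J by (rule measure_Un_le)
  also have "K.prob ?J \<le> L * (\<delta> - \<delta>')"
  proof -
    have "emeasure (\<kappa> n \<omega>) ?J = (\<integral>\<^sup>+s. ennreal (f s) * indicator {q + \<delta>'..q + \<delta>} s \<partial>lborel)"
      using dens by (rule distributed_emeasure) simp
    also have "\<dots> \<le> (\<integral>\<^sup>+s. ennreal L * indicator {q + \<delta>'..q + \<delta>} s \<partial>lborel)"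
      using bound by (intro nn_integral_mono mult_right_mono ennreal_leI) auto
    also have "\<dots> = ennreal L * ennreal (\<delta> - \<delta>')"
      using assms(4) by (simp add: nn_integral_cmult_indicator)
    finally have "ennreal (K.prob ?J) \<le> ennreal (L * (\<delta> - \<delta>'))"
      using assms(3,4) by (simp add: K.emeasure_eq_measure ennreal_mult)
    then show ?thesis using assms(3,4) by simp
  qed
  finally show ?thesis by simp
qed

lemma loo_ecdf_constant:
  assumes n: "n \<ge> 1"
  shows "AE \<omega> in M. AE d in \<kappa> n \<omega>. loo_ecdf A n d = loo_ecdf A n (random_sample t n n \<omega>)"
proof -
  have meas: "loo_score A n i \<in> borel_measurable (sample_space (Y n) (p n) n)" if i: "i \<in> {1..n}" for i
  proof -
    have [measurable]: "(\<lambda>d. fst (d i)) \<in> borel_measurable (sample_space (Y n) (p n) n)"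
      by (rule measurable_compose[OF measurable_entry[OF i] measurable_response])
    have [measurable]: "(\<lambda>d. A n (n - 1) (snd (d i)) (drop_entry n i d))
        \<in> borel_measurable (sample_space (Y n) (p n) n)"
      using measurable_prediction[OF n i, of "n - 1"] n by simp
    show ?thesis unfolding loo_score_def[abs_def] by measurable
  qed
  have "AE \<omega> in M. \<forall>i\<in>{1..n}. AE d in \<kappa> n \<omega>.
      loo_score A n i (restrict d {1..n}) = loo_score A n i (random_sample t n n \<omega>)"
    by (rule AE_finite_allI) (use kernel_fixes_training[OF n meas] in blast)+
  then show ?thesis
  proof eventually_elim
    case (elim \<omega>)
    have "AE d in \<kappa> n \<omega>. \<forall>i\<in>{1..n}.
        loo_score A n i (restrict d {1..n}) = loo_score A n i (random_sample t n n \<omega>)"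
      using elim by (intro AE_finite_allI) auto
    then show ?case
    proof eventually_elim
      case (elim d)
      have "loo_ecdf A n (restrict d {1..n}) = loo_ecdf A n (random_sample t n n \<omega>)"
        unfolding loo_ecdf_def fun_eq_iff
        by (intro allI arg_cong[where f="(*) (1 / real n)"] sum.cong[OF refl]) (simp only: elim)
      then show ?case by (simp only: loo_ecdf_restrict)
    qed
  qed
qed

lemma deviation_diff_le:
  assumes n: "n \<ge> 1" and \<omega>: "\<omega> \<in> space M" and "L \<ge> 0" "\<eta> > 0" "\<theta> > 0"
    and const: "AE d in \<kappa> n \<omega>. loo_ecdf A n d = H"
    and dens: "distributed (\<kappa> n \<omega>) lborel (fc_score A n (n + 1)) (\<lambda>s. ennreal (f s))"
    and bound: "\<And>s. f s \<le> L"
  shows "\<bar>deviation fc_ecdf n \<omega> - deviation loo_ecdf n \<omega>\<bar> \<le>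
    (\<theta> + 1 / real n) + (unstable_prob n \<eta> \<theta> \<omega> + L * \<eta>)"
proof -
  let ?\<tau> = "\<theta> + 1 / real n" and ?b = "unstable_prob n \<eta> \<theta> \<omega> + L * \<eta>"
  note inflation = miss_prob_loo_inflation[OF n \<omega> assms(3) _ const dens bound]
  \<comment> \<open>The inflation changes only in the Jackknife term, the one with a constant quantile: after
    the comparison in the first inequality, before it in the second.\<close>
  have fc: "miss_prob fc_ecdf n \<alpha> 0 \<omega> \<le> miss_prob loo_ecdf n (\<alpha> + ?\<tau>) 0 \<omega> + ?b" for \<alpha>
    using miss_prob_le[OF n \<omega>, of fc_ecdf loo_ecdf \<alpha> 0 \<theta> \<eta>] inflation[of "- \<eta>" 0 "\<alpha> + ?\<tau>"] assms(4)
    by simp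
  have loo: "miss_prob loo_ecdf n \<alpha> 0 \<omega> \<le> miss_prob fc_ecdf n (\<alpha> + ?\<tau>) 0 \<omega> + ?b" for \<alpha>
    using miss_prob_le[OF n \<omega>, of loo_ecdf fc_ecdf \<alpha> \<eta> \<theta> \<eta>] inflation[of 0 \<eta> \<alpha>] assms(4)
    by simp
  have nonneg: "?\<tau> \<ge> 0" "?b \<ge> 0"
    using assms(3-5) unstable_prob_nonneg[of n \<eta> \<theta> \<omega>] by auto
  note range = miss_prob_range[OF n \<omega>]
  have "deviation fc_ecdf n \<omega> \<le> deviation loo_ecdf n \<omega> + ?\<tau> + ?b"
    unfolding deviation_def by (rule SUP_abs_level_shift; fact range nonneg fc loo)
  moreover have "deviation loo_ecdf n \<omega> \<le> deviation fc_ecdf n \<omega> + ?\<tau> + ?b"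
    unfolding deviation_def by (rule SUP_abs_level_shift; fact range nonneg fc loo)
  ultimately show ?thesis by (simp add: abs_le_iff)
qed

lemma integral_deviation_diff_tendsto:
  assumes stable: "out_of_sample_stable M t A" and cc: "continuous_case M t \<kappa> (score_out A)"
  shows "(\<lambda>n. (\<integral>\<omega>. deviation fc_ecdf n \<omega> \<partial>M) - (\<integral>\<omega>. deviation loo_ecdf n \<omega> \<partial>M)) \<longlonglongrightarrow> 0"
proof (rule LIMSEQ_I)
  fix \<epsilon> :: real assume \<epsilon>: "\<epsilon> > 0"
  obtain f where
    dens: "\<And>n. n \<ge> 1 \<Longrightarrow> AE \<omega> in M. (\<forall>s. f n (random_sample t n n \<omega>) s \<ge> (0::real)) \<and>
        distributed (\<kappa> n \<omega>) lborel (\<lambda>d. score_out A n n (d (n + 1)) (restrict d {1..n}))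
          (\<lambda>s. ennreal (f n (random_sample t n n \<omega>) s))"
    and bounded: "stochastically_bounded M (\<lambda>n \<omega>. sup_norm (f n (random_sample t n n \<omega>)))"
    using cc unfolding continuous_case_def by blast
  obtain L0 where L0: "\<forall>n\<ge>1. \<exists>E\<in>events. prob E \<ge> 1 - \<epsilon> / 5 \<and>
      (\<forall>\<omega>\<in>E. sup_norm (f n (random_sample t n n \<omega>)) \<le> ennreal L0)"
    using bounded \<epsilon> unfolding stochastically_bounded_def by (meson divide_pos_pos zero_less_numeral)
  define L where "L = max L0 1"
  have L: "L > 0" "ennreal L0 \<le> ennreal L" by (auto simp: L_def intro: ennreal_leI)
  \<comment> \<open>Five error terms of size at most \<open>\<epsilon> / 5\<close>: \<open>\<theta>\<close>, \<open>1 / n\<close>, \<open>L * \<eta>\<close>, the expected probability of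
    the unstable event, and the probability that the density exceeds \<open>L\<close>.\<close>
  define \<eta> \<theta> where "\<eta> = \<epsilon> / (5 * L)" and "\<theta> = \<epsilon> / 5"
  have pos: "\<eta> > 0" "\<theta> > 0" and L\<eta>: "L * \<eta> = \<epsilon> / 5"
    using \<epsilon> L by (auto simp: \<eta>_def \<theta>_def)
  have "\<forall>\<^sub>F n in sequentially. (\<integral>\<omega>. unstable_prob n \<eta> \<theta> \<omega> \<partial>M) < \<epsilon> / 5"
    using integral_unstable_event_tendsto[OF stable pos] \<epsilon>
    by (intro order_tendstoD) (auto simp: unstable_prob_def[abs_def])
  moreover have "\<forall>\<^sub>F n in sequentially. 1 / real n < \<epsilon> / 5"
    using lim_1_over_n \<epsilon> by (intro order_tendstoD) auto
  ultimately have "\<forall>\<^sub>F n in sequentially.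
      norm ((\<integral>\<omega>. deviation fc_ecdf n \<omega> \<partial>M) - (\<integral>\<omega>. deviation loo_ecdf n \<omega> \<partial>M) - 0) < \<epsilon>"
    using eventually_ge_at_top[of 1]
  proof eventually_elim
    case (elim n)
    then have n: "n \<ge> 1" by simp
    obtain E where E: "E \<in> events" "prob E \<ge> 1 - \<epsilon> / 5"
      and EL: "\<And>\<omega>. \<omega> \<in> E \<Longrightarrow> sup_norm (f n (random_sample t n n \<omega>)) \<le> ennreal L0"
      using L0 n by blast
    let ?fc = "deviation fc_ecdf n" and ?loo = "deviation loo_ecdf n"
    let ?u = "unstable_prob n \<eta> \<theta>"
    let ?c = "\<theta> + 1 / real n + L * \<eta>"
    have score: "(\<lambda>d. score_out A n n (d (n + 1)) (restrict d {1..n})) = fc_score A n (n + 1)"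
      unfolding fun_eq_iff score_out_def fc_score_def drop_last_entry by simp
    have "AE \<omega> in M. \<bar>?fc \<omega> - ?loo \<omega>\<bar> \<le> ?c + ?u \<omega> + indicator (space M - E) \<omega>"
      using dens[OF n] loo_ecdf_constant[OF n] AE_space
    proof eventually_elim
      case (elim \<omega>)
      show ?case
      proof (cases "\<omega> \<in> E")
        case True
        have "f n (random_sample t n n \<omega>) s \<le> L" for s
        proof -
          have "ennreal \<bar>f n (random_sample t n n \<omega>) s\<bar> \<le> sup_norm (f n (random_sample t n n \<omega>))"
            unfolding sup_norm_def by (rule SUP_upper) simp
          also have "\<dots> \<le> ennreal L" using EL[OF True] L(2) by (rule order_trans)
          finally show ?thesis using L(1) by simp
        qed
        with deviation_diff_le[OF n _ _ pos, of \<omega> L] elim L(1) score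
        have "\<bar>?fc \<omega> - ?loo \<omega>\<bar> \<le> (\<theta> + 1 / real n) + (?u \<omega> + L * \<eta>)" by auto
        then show ?thesis using True by simp
      next
        case False
        have "\<bar>?fc \<omega> - ?loo \<omega>\<bar> \<le> 1"
          using deviation_range[OF n, of \<omega> fc_ecdf] deviation_range[OF n, of \<omega> loo_ecdf] elim(3)
          by (auto simp: abs_le_iff)
        moreover have "?c + ?u \<omega> \<ge> 0"
          using pos L(1) unstable_prob_nonneg[of n \<eta> \<theta> \<omega>] by (intro add_nonneg_nonneg) auto
        ultimately show ?thesis using False elim(3) by simp
      qed
    qed
    note AE_le = this
    note int = integrable_deviation[OF n, of fc_ecdf] integrable_deviation[OF n, of loo_ecdf]
      integrable_unstable_prob[OF n, of \<eta> \<theta>]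
    have intE: "integrable M (indicator (space M - E) :: 'w \<Rightarrow> real)"
      using E(1) by (intro integrable_real_indicator) (auto simp: emeasure_eq_measure)
    have "\<bar>(\<integral>\<omega>. ?fc \<omega> \<partial>M) - (\<integral>\<omega>. ?loo \<omega> \<partial>M)\<bar> = \<bar>\<integral>\<omega>. ?fc \<omega> - ?loo \<omega> \<partial>M\<bar>"
      using int by (simp add: Bochner_Integration.integral_diff)
    also have "\<dots> \<le> (\<integral>\<omega>. \<bar>?fc \<omega> - ?loo \<omega>\<bar> \<partial>M)"
      by (rule integral_abs_bound)
    also have "\<dots> \<le> (\<integral>\<omega>. ?c + ?u \<omega> + indicator (space M - E) \<omega> \<partial>M)"
      using int intE AE_le by (intro integral_mono_AE) auto
    also have "\<dots> = ?c + (\<integral>\<omega>. ?u \<omega> \<partial>M) + prob (space M - E)"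
      using int intE E(1) by (simp add: prob_space)
    also have "prob (space M - E) = 1 - prob E" using E(1) by (rule prob_compl)
    finally show ?case using elim E(2) L\<eta> by (simp add: \<theta>_def)
  qed
  then show "\<exists>no. \<forall>n\<ge>no.
      norm ((\<integral>\<omega>. deviation fc_ecdf n \<omega> \<partial>M) - (\<integral>\<omega>. deviation loo_ecdf n \<omega> \<partial>M) - 0) < \<epsilon>"
    by (simp add: eventually_sequentially)
qed

lemma asymp_cond_valid_iff:
  assumes PS: "\<And>n \<omega> \<alpha> \<delta>. n \<ge> 1 \<Longrightarrow> \<omega> \<in> space M \<Longrightarrow> miscoverage \<kappa> PS n \<alpha> \<delta> \<omega> = miss_prob F n \<alpha> \<delta> \<omega>"
  shows "asymp_cond_valid M \<kappa> PS \<longleftrightarrow> (\<lambda>n. \<integral>\<omega>. deviation F n \<omega> \<partial>M) \<longlonglongrightarrow> 0"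
  unfolding asymp_cond_valid_def
proof (rule filterlim_cong[OF refl refl])
  show "\<forall>\<^sub>F n in sequentially. (\<integral>\<omega>. (SUP \<alpha>\<in>{0..1}. \<bar>miscoverage \<kappa> PS n \<alpha> 0 \<omega> - \<alpha>\<bar>) \<partial>M) =
      (\<integral>\<omega>. deviation F n \<omega> \<partial>M)"
    using eventually_ge_at_top[of 1]
  proof eventually_elim
    case (elim n)
    show ?case
      by (intro Bochner_Integration.integral_cong refl) (simp only: deviation_def PS[OF elim])
  qed
qed

section \<open>Equivalence of the two methods\<close>

lemma conservative_equivalence:
  assumes "out_of_sample_stable M t A"
  shows "asymp_cond_conservative M \<kappa> (PS_fc Y (score_out A)) \<longleftrightarrow>
    asymp_cond_conservative M \<kappa> (PI_sJ Y A)"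
proof -
  have "asymp_cond_conservative M \<kappa> (PS_fc Y (score_out A)) \<longleftrightarrow>
      (\<forall>\<delta>>0. \<forall>\<epsilon>>0. (\<lambda>n. prob {\<omega> \<in> space M. \<epsilon> \<le> excess fc_ecdf n \<delta> \<omega>}) \<longlonglongrightarrow> 0)"
    by (rule asymp_cond_conservative_iff) (rule miscoverage_fc)
  moreover have "asymp_cond_conservative M \<kappa> (PI_sJ Y A) \<longleftrightarrow>
      (\<forall>\<delta>>0. \<forall>\<epsilon>>0. (\<lambda>n. prob {\<omega> \<in> space M. \<epsilon> \<le> excess loo_ecdf n \<delta> \<omega>}) \<longlonglongrightarrow> 0)"
    by (rule asymp_cond_conservative_iff) (rule miscoverage_sJ)
  ultimately show ?thesis
    using conservative_transfer[OF assms, of fc_ecdf loo_ecdf]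
      conservative_transfer[OF assms, of loo_ecdf fc_ecdf] by blast
qed

lemma valid_equivalence:
  assumes "out_of_sample_stable M t A" and "continuous_case M t \<kappa> (score_out A)"
  shows "asymp_cond_valid M \<kappa> (PS_fc Y (score_out A)) \<longleftrightarrow> asymp_cond_valid M \<kappa> (PI_sJ Y A)"
proof -
  have "asymp_cond_valid M \<kappa> (PS_fc Y (score_out A)) \<longleftrightarrow>
      (\<lambda>n. \<integral>\<omega>. deviation fc_ecdf n \<omega> \<partial>M) \<longlonglongrightarrow> 0"
    by (rule asymp_cond_valid_iff) (rule miscoverage_fc)
  also have "\<dots> \<longleftrightarrow> (\<lambda>n. \<integral>\<omega>. deviation loo_ecdf n \<omega> \<partial>M) \<longlonglongrightarrow> 0"
    using integral_deviation_diff_tendsto[OF assms] by (rule Lim_transform_eq)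
  also have "\<dots> \<longleftrightarrow> asymp_cond_valid M \<kappa> (PI_sJ Y A)"
    by (rule asymp_cond_valid_iff[symmetric]) (rule miscoverage_sJ)
  finally show ?thesis .
qed

end

theorem corollary4p8:
  fixes M :: "'w measure"
    and Y :: "nat \<Rightarrow> real set"
    and p :: "nat \<Rightarrow> nat"
    and P :: "nat \<Rightarrow> observation measure"
    and t :: "nat \<Rightarrow> nat \<Rightarrow> 'w \<Rightarrow> observation"
    and \<kappa> :: "nat \<Rightarrow> 'w \<Rightarrow> sample measure"
    and A :: algorithm
  assumes "prob_space M"
    and "\<And>n. n \<ge> 1 \<Longrightarrow> is_interval (Y n)"
    and "\<And>n. n \<ge> 1 \<Longrightarrow> prob_space (P n)"
    and "\<And>n. n \<ge> 1 \<Longrightarrow> sets (P n) = sets (observation_space (Y n) (p n))"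
    and "\<And>n. n \<ge> 1 \<Longrightarrow>
      prob_space.indep_vars M (\<lambda>i. observation_space (Y n) (p n)) (t n) {1..n + 1}"
    and "\<And>n i. n \<ge> 1 \<Longrightarrow> i \<in> {1..n + 1} \<Longrightarrow>
      distr M (observation_space (Y n) (p n)) (t n i) = P n"
    and "\<And>n. n \<ge> 1 \<Longrightarrow>
      regular_cond_distr M (training_algebra M Y p t n)
        (sample_space (Y n) (p n) (n + 1)) (random_sample t n (n + 1)) (\<kappa> n)"
    and "prediction_algorithm Y p A"
    and "symmetric_algorithm Y p A"
  shows "(\<forall>n\<ge>1. \<forall>\<alpha> \<delta>. \<forall>T\<in>space (sample_space (Y n) (p n) n). \<forall>x\<in>space (covariate_space (p n)).
            PS_sc Y (score_out A) n \<alpha> \<delta> T x = PI_sJ Y A n \<alpha> \<delta> T x) \<and>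
         (out_of_sample_stable M t A \<longrightarrow>
            (asymp_cond_conservative M \<kappa> (PS_fc Y (score_out A)) \<longleftrightarrow>
              asymp_cond_conservative M \<kappa> (PI_sJ Y A)) \<and>
            (continuous_case M t \<kappa> (score_out A) \<longrightarrow>
              (asymp_cond_valid M \<kappa> (PS_fc Y (score_out A)) \<longleftrightarrow>
                asymp_cond_valid M \<kappa> (PI_sJ Y A))))"
proof -
  interpret prob_space M by fact
  interpret iid_prediction M Y p P t \<kappa> A
    by (intro iid_prediction.intro iid_prediction_axioms.intro assms) assumption+
  show ?thesis
    using PS_sc_eq_PI_sJ conservative_equivalence valid_equivalence by blast
qed

end
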